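(* Let $b:\mathbb{R}^d\times\mathscr{P}(\mathbb{R}^d)\to\mathbb{R}^d$ and $\sigma:\mathbb{R}^d\times\mathscr{P}(\mathbb{R}^d)\to\mathbb{R}^d\otimes\mathbb{R}^n$ be measurable and bounded on bounded sets, let $(Z_t)_{t\ge 0}$ be an $n$-dimensional Lévy process, and consider the McKean--Vlasov SDE $$\mathrm{d}X_t=b(X_t,\mathscr{L}_{X_t})\,\mathrm{d}t+\sigma(X_{t-},\mathscr{L}_{X_t})\,\mathrm{d}Z_t \qquad (\mathrm{E})$$ and, for each $\mu\in\mathscr{P}_1(\mathbb{R}^d)$, the decoupled SDE $$\mathrm{d}X^\mu_t=b(X^\mu_t,\mu)\,\mathrm{d}t+\sigma(X^\mu_{t-},\mu)\,\mathrm{d}Z_t. \qquad (\mathrm{E}_\mu)$$ Suppose that $(\mathrm{E})$ and $(\mathrm{E}_\mu)$, $\mu\in\mathscr{P}_1(\mathbb{R}^d)$, are well-posed for initial distributions in $\mathscr{P}_1(\mathbb{R}^d)$, and let $P_t^*\eta$ (resp. $(P_t^\mu)^*\eta$) be the law at time $t$ of the solution to $(\mathrm{E})$ (resp. $(\mathrm{E}_\mu)$) with initial distribution $\eta\in\mathscr{P}_1(\mathbb{R}^d)$. Assume that for any $\mu\in\mathscr{P}_1(\mathbb{R}^d)$ there exists a unique invariant probability measure $\Gamma(\mu)\in\mathscr{P}_1(\mathbb{R}^d)$ of $(\mathrm{E}_\mu)$, such that $$\mathbb{W}_1((P_t^\mu)^*\eta,\Gamma(\mu))\le c_0\mathrm{e}^{-\lambda_0t}\,\mathbb{W}_1(\eta,\Gamma(\mu)),\qquad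 t\ge0,\ \eta,\mu\in\mathscr{P}_1(\mathbb{R}^d),$$ for some constants $c_0\ge1$ and $\lambda_0>0$ not depending on $\mu$. (i) Suppose that there exists a continuous function $G:[0,\infty)\to[0,\infty)$ satisfying $$\inf_{t>\frac{\log c_0}{\lambda_0}}\frac{G(t)}{1-c_0\mathrm{e}^{-\lambda_0t}}\in[0,1)$$ such that $$\mathbb{W}_1((P_t^{\mu_1})^*\Gamma(\mu_2),\Gamma(\mu_2))\le G(t)\,\mathbb{W}_1(\mu_1,\mu_2),\qquad t\ge0,\ \mu_1,\mu_2\in\mathscr{P}_1(\mathbb{R}^d).$$ Then there exists a unique invariant probability measure $\mu^*\in\mathscr{P}_1(\mathbb{R}^d)$ for $(\mathrm{E})$. (ii) Let $\nu\in\mathscr{P}_1(\mathbb{R}^d)$ be an invariant probability measure for $(\mathrm{E})$. Assume that there exist a constant $t_1>0$ and a continuous function $H:[0,t_1]\to[0,\infty)$ with $H(t_1)+c_0\mathrm{e}^{-\lambda_0t_1}<1$ such that $$\mathbb{W}_1(P_t^*\eta,(P_t^\nu)^*\eta)\le H(t)\,\mathbb{W}_1(\eta,\nu),\qquad \eta\in\mathscr{P}_1(\mathbb{R}^d),\ t\in[0,t_1].$$ Then there exist constants $c,\lambda>0$ such that $$\mathbb{W}_1(P_t^*\eta,\nu)\le c\,\mathrm{e}^{-\lambda t}\,\mathbb{W}_1(\eta,\nu),\qquad t\ge0,\ \eta\in\mathscr{P}_1(\mathbb{R}^d).$$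
   Context: $\mathscr{P}(\mathbb{R}^d)$ is the set of probability measures on $\mathbb{R}^d$ with the weak topology, $\mathscr{P}_1(\mathbb{R}^d)$ is the subset of those with finite first moment, and $\mathbb{W}_1(\mu,\nu)=\inf_{\pi}\int|x-y|\,\pi(\mathrm{d}x,\mathrm{d}y)$, the infimum being over all couplings $\pi$ of $\mu,\nu$. $\mathscr{L}_X$ denotes the law of the random variable $X$. The Lévy process lives on a complete filtered probability space. Well-posedness for initial distributions in $\mathscr{P}_1(\mathbb{R}^d)$ means that for every initial law in $\mathscr{P}_1(\mathbb{R}^d)$ there is a unique solution, whose time-marginal laws stay in $\mathscr{P}_1(\mathbb{R}^d)$; since the coefficients do not depend on time, the semigroup properties $P_{t+s}^*=P_t^*P_s^*$ and $(P_{t+s}^\mu)^*=(P_t^\mu)^*(P_s^\mu)^*$ hold for $s,t\ge0$. A measure $\nu\in\mathscr{P}_1(\mathbb{R}^d)$ is an invariant probability measure of $(\mathrm{E})$ (resp. $(\mathrm{E}_\mu)$) if $P_t^*\nu=\nu$ (resp. $(P_t^\mu)^*\nu=\nu$) for all $t\ge0$. *)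

theory Defs
  imports "HOL-Probability.Probability"
begin

section \<open>Probability measures and the Wasserstein distance\<close>

definition prob_measures :: "'a::topological_space measure set" where
  "prob_measures = {\<mu>. prob_space \<mu> \<and> sets \<mu> = sets borel}"

definition weak_topology :: "'a::topological_space measure topology" where
  "weak_topology = topology_generated_by
     {{\<mu> \<in> prob_measures. (\<integral>x. f x \<partial>\<mu>) \<in> U} | (f :: 'a \<Rightarrow> real) U.
        continuous_on UNIV f \<and> bounded (range f) \<and> open U}"

definition borel_sigma :: "'a topology \<Rightarrow> 'a measure" where
  "borel_sigma T = sigma (topspace T) {U. openin T U}"

definition P1 :: "'a::euclidean_space measure set" where
  "P1 = {\<mu> \<in> prob_measures. integrable \<mu> norm}"

definition couplings :: "'a::euclidean_space measure \<Rightarrow> 'a measure \<Rightarrow> ('a \<times> 'a) measure set" where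
  "couplings \<mu> \<nu> = {\<pi> \<in> prob_measures. distr \<pi> borel fst = \<mu> \<and> distr \<pi> borel snd = \<nu>}"

definition W1 :: "'a::euclidean_space measure \<Rightarrow> 'a measure \<Rightarrow> ennreal" where
  "W1 \<mu> \<nu> = (INF \<pi> \<in> couplings \<mu> \<nu>. \<integral>\<^sup>+ (x, y). ennreal (norm (x - y)) \<partial>\<pi>)"

text \<open>Bounded subsets of the product of the state space with \<^const>\<open>P1\<close> are understood with
  respect to \<^const>\<open>W1\<close>: the first moment of \<open>\<mu>\<close> is its distance to the Dirac measure at \<open>0\<close>.\<close>

definition bounded_on_bounded_sets ::
    "('a::euclidean_space \<Rightarrow> 'a measure \<Rightarrow> 'b::real_normed_vector) \<Rightarrow> bool" where
  "bounded_on_bounded_sets f \<longleftrightarrow>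
     (\<forall>R. bounded {f x \<mu> | x \<mu>. norm x \<le> R \<and> \<mu> \<in> P1 \<and> (\<integral>y. norm y \<partial>\<mu>) \<le> R})"

definition measurable_coefficient ::
    "('a::euclidean_space \<Rightarrow> 'a measure \<Rightarrow> 'b::euclidean_space) \<Rightarrow> bool" where
  "measurable_coefficient f \<longleftrightarrow>
     (\<lambda>(x, \<mu>). f x \<mu>) \<in> borel_measurable (borel_sigma (prod_topology euclidean weak_topology))"


section \<open>Processes on filtered probability spaces\<close>

text \<open>The time set is the half-line \<open>{0..}\<close>; processes and filtrations are functions on
  \<^typ>\<open>real\<close> whose values at negative times are irrelevant. No right-continuity of the filtration
  is required.\<close>

definition complete_filtered_prob_space :: "'w measure \<Rightarrow> (real \<Rightarrow> 'w measure) \<Rightarrow> bool" where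
  "complete_filtered_prob_space M F \<longleftrightarrow>
     prob_space M \<and> complete_measure M \<and>
     (\<forall>t\<ge>0. space (F t) = space M \<and> sets (F t) \<subseteq> sets M) \<and>
     (\<forall>s t. 0 \<le> s \<and> s \<le> t \<longrightarrow> sets (F s) \<subseteq> sets (F t)) \<and>
     null_sets M \<subseteq> sets (F 0)"

definition adapted :: "(real \<Rightarrow> 'w measure) \<Rightarrow> (real \<Rightarrow> 'w \<Rightarrow> 'a::topological_space) \<Rightarrow> bool" where
  "adapted F X \<longleftrightarrow> (\<forall>t\<ge>0. X t \<in> borel_measurable (F t))"

definition cadlag :: "(real \<Rightarrow> 'a::topological_space) \<Rightarrow> bool" where
  "cadlag x \<longleftrightarrow> (\<forall>t\<ge>0. (x \<longlongrightarrow> x t) (at_right t)) \<and> (\<forall>t>0. \<exists>l. (x \<longlongrightarrow> l) (at_left t))"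

definition cadlag_adapted ::
    "'w measure \<Rightarrow> (real \<Rightarrow> 'w measure) \<Rightarrow> (real \<Rightarrow> 'w \<Rightarrow> 'a::topological_space) \<Rightarrow> bool" where
  "cadlag_adapted M F X \<longleftrightarrow> adapted F X \<and> (\<forall>\<omega>\<in>space M. cadlag (\<lambda>t. X t \<omega>))"

definition left_limit :: "(real \<Rightarrow> 'w \<Rightarrow> 'a::t2_space) \<Rightarrow> real \<Rightarrow> 'w \<Rightarrow> 'a" where
  "left_limit X t \<omega> = Lim (at_left t) (\<lambda>s. X s \<omega>)"

abbreviation law :: "'w measure \<Rightarrow> ('w \<Rightarrow> 'a::topological_space) \<Rightarrow> 'a measure" where
  "law M X \<equiv> distr M borel X"

definition process_law ::
    "'w measure \<Rightarrow> (real \<Rightarrow> 'w \<Rightarrow> 'a::topological_space) \<Rightarrow> (real \<Rightarrow> 'a) measure" where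
  "process_law M X = distr M (\<Pi>\<^sub>M t\<in>{0..}. borel) (\<lambda>\<omega>. \<lambda>t\<in>{0..}. X t \<omega>)"

definition levy_process ::
    "'w measure \<Rightarrow> (real \<Rightarrow> 'w measure) \<Rightarrow> (real \<Rightarrow> 'w \<Rightarrow> 'a::euclidean_space) \<Rightarrow> bool" where
  "levy_process M F Z \<longleftrightarrow>
     cadlag_adapted M F Z \<and> (AE \<omega> in M. Z 0 \<omega> = 0) \<and>
     (\<forall>s t. 0 \<le> s \<and> s \<le> t \<longrightarrow>
        prob_space.indep_set M (sets (F s))
          {(\<lambda>\<omega>. Z t \<omega> - Z s \<omega>) -` A \<inter> space M | A. A \<in> sets borel} \<and>
        law M (\<lambda>\<omega>. Z t \<omega> - Z s \<omega>) = law M (Z (t - s)))"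


section \<open>The stochastic integral\<close>

text \<open>Finite stopping times suffice for localization: replace \<open>T m\<close> by its minimum with \<open>m\<close>.\<close>

definition finite_stopping_time ::
    "'w measure \<Rightarrow> (real \<Rightarrow> 'w measure) \<Rightarrow> ('w \<Rightarrow> real) \<Rightarrow> bool" where
  "finite_stopping_time M F T \<longleftrightarrow> (\<forall>t\<ge>0. {\<omega> \<in> space M. T \<omega> \<le> t} \<in> sets (F t))"

definition locally_uniformly_bounded ::
    "'w measure \<Rightarrow> (real \<Rightarrow> 'w measure) \<Rightarrow> (nat \<Rightarrow> real \<Rightarrow> 'w \<Rightarrow> 'a::real_normed_vector) \<Rightarrow> bool" where
  "locally_uniformly_bounded M F H \<longleftrightarrow>
     (\<exists>T C. (\<forall>m. finite_stopping_time M F (T m)) \<and>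
        (AE \<omega> in M. incseq (\<lambda>m. T m \<omega>) \<and> filterlim (\<lambda>m. T m \<omega>) at_top sequentially) \<and>
        (\<forall>m::nat. AE \<omega> in M. \<forall>k t. 0 < t \<and> t \<le> T m \<omega> \<longrightarrow> norm (H k t \<omega>) \<le> C m))"

definition tendsto_in_prob ::
    "'w measure \<Rightarrow> (nat \<Rightarrow> 'w \<Rightarrow> 'a::metric_space) \<Rightarrow> ('w \<Rightarrow> 'a) \<Rightarrow> bool" where
  "tendsto_in_prob M Y Y' \<longleftrightarrow>
     (\<forall>\<epsilon>>0. (\<lambda>k. measure M {\<omega> \<in> space M. dist (Y k \<omega>) (Y' \<omega>) > \<epsilon>}) \<longlonglongrightarrow> 0)"

text \<open>\<open>stoch_integral M F Z H I\<close> says that \<open>I t\<close> is the stochastic integral of \<open>H\<close> over \<open>]0, t]\<close>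
  with respect to \<open>Z\<close>. For a semimartingale \<open>Z\<close>, the integral of locally bounded predictable
  processes is the unique extension of the elementary integral that satisfies dominated convergence
  in probability (Jacod and Shiryaev, \<^emph>\<open>Limit Theorems for Stochastic Processes\<close>,
  Theorem I.4.31). Its graph, up to indistinguishability, is obtained by closing the elementary
  integral under dominated limits; the dominating locally bounded process is the supremum of the
  sequence. Predictability of \<open>H\<close>, up to indistinguishability, is implied because \<open>H\<close> is built from
  elementary predictable processes; its values at times \<open>t \<le> 0\<close> play no role.\<close>

inductive stoch_integral ::
    "'w measure \<Rightarrow> (real \<Rightarrow> 'w measure) \<Rightarrow> (real \<Rightarrow> 'w \<Rightarrow> real^'n) \<Rightarrow>
     (real \<Rightarrow> 'w \<Rightarrow> real^'n^'d) \<Rightarrow> (real \<Rightarrow> 'w \<Rightarrow> real^'d) \<Rightarrow> bool"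
  for M :: "'w measure" and F :: "real \<Rightarrow> 'w measure" and Z :: "real \<Rightarrow> 'w \<Rightarrow> real^'n"
where
  elementary: "stoch_integral M F Z
       (\<lambda>t \<omega>. \<Sum>i<k. if u i < t \<and> t \<le> v i then \<xi> i \<omega> else 0)
       (\<lambda>t \<omega>. \<Sum>i<k. \<xi> i \<omega> *v (Z (min t (v i)) \<omega> - Z (min t (u i)) \<omega>))"
    if "\<forall>i<k::nat. 0 \<le> u i \<and> u i \<le> v i \<and> \<xi> i \<in> borel_measurable (F (u i)) \<and> bounded (\<xi> i ` space M)"
| dominated_limit: "stoch_integral M F Z H I"
    if "\<forall>k. stoch_integral M F Z (Hs k) (Is k)"
      and "locally_uniformly_bounded M F Hs"
      and "AE \<omega> in M. \<forall>t>0. (\<lambda>k. Hs k t \<omega>) \<longlonglongrightarrow> H t \<omega>"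
      and "cadlag_adapted M F I"
      and "\<forall>t\<ge>0. tendsto_in_prob M (\<lambda>k. Is k t) (I t)"


section \<open>Solutions, well-posedness and invariant measures\<close>

text \<open>The drift \<open>b\<close> and the noise coefficient \<open>\<sigma>\<close> take the state and the law of the solution.
  An equation without dependence on the law is the case where both ignore their second argument.\<close>

definition solves_sde ::
    "(real^'d \<Rightarrow> (real^'d) measure \<Rightarrow> real^'d) \<Rightarrow> (real^'d \<Rightarrow> (real^'d) measure \<Rightarrow> real^'n^'d) \<Rightarrow>
     'w measure \<Rightarrow> (real \<Rightarrow> 'w measure) \<Rightarrow> (real \<Rightarrow> 'w \<Rightarrow> real^'n) \<Rightarrow> (real \<Rightarrow> 'w \<Rightarrow> real^'d) \<Rightarrow> bool" where
  "solves_sde b \<sigma> M F Z X \<longleftrightarrow>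
     cadlag_adapted M F X \<and>
     (\<exists>I. stoch_integral M F Z (\<lambda>t \<omega>. \<sigma> (left_limit X t \<omega>) (law M (X t))) I \<and>
        (AE \<omega> in M. \<forall>t\<ge>0.
           set_integrable lborel {0..t} (\<lambda>s. b (X s \<omega>) (law M (X s))) \<and>
           X t \<omega> = X 0 \<omega> + (LINT s:{0..t}|lborel. b (X s \<omega>) (law M (X s))) + I t \<omega>))"

text \<open>Uniqueness in \<open>well_posed\<close> is uniqueness in law. Solutions are weak: the filtered probability space and the driving Levy process are part of
  the solution, and only the law of the given Levy process \<open>Z\<^sub>0\<close> on \<open>M\<^sub>0\<close> is prescribed. The law
  of a Levy process is determined by its one-dimensional marginals.\<close>

definition weak_solution ::
    "(real^'d \<Rightarrow> (real^'d) measure \<Rightarrow> real^'d) \<Rightarrow> (real^'d \<Rightarrow> (real^'d) measure \<Rightarrow> real^'n^'d) \<Rightarrow>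
     'w measure \<Rightarrow> (real \<Rightarrow> 'w \<Rightarrow> real^'n) \<Rightarrow> (real^'d) measure \<Rightarrow>
     'w measure \<Rightarrow> (real \<Rightarrow> 'w measure) \<Rightarrow> (real \<Rightarrow> 'w \<Rightarrow> real^'n) \<Rightarrow> (real \<Rightarrow> 'w \<Rightarrow> real^'d) \<Rightarrow> bool" where
  "weak_solution b \<sigma> M\<^sub>0 Z\<^sub>0 \<eta> M F Z X \<longleftrightarrow>
     complete_filtered_prob_space M F \<and> levy_process M F Z \<and>
     (\<forall>t\<ge>0. law M (Z t) = law M\<^sub>0 (Z\<^sub>0 t)) \<and>
     solves_sde b \<sigma> M F Z X \<and> law M (X 0) = \<eta>"

definition well_posed ::
    "(real^'d \<Rightarrow> (real^'d) measure \<Rightarrow> real^'d) \<Rightarrow> (real^'d \<Rightarrow> (real^'d) measure \<Rightarrow> real^'n^'d) \<Rightarrow>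
     'w measure \<Rightarrow> (real \<Rightarrow> 'w \<Rightarrow> real^'n) \<Rightarrow> bool" where
  "well_posed b \<sigma> M\<^sub>0 Z\<^sub>0 \<longleftrightarrow>
     (\<forall>\<eta>\<in>P1.
        (\<exists>M F Z X. weak_solution b \<sigma> M\<^sub>0 Z\<^sub>0 \<eta> M F Z X) \<and>
        (\<forall>M F Z X M' F' Z' X'.
           weak_solution b \<sigma> M\<^sub>0 Z\<^sub>0 \<eta> M F Z X \<and> weak_solution b \<sigma> M\<^sub>0 Z\<^sub>0 \<eta> M' F' Z' X' \<longrightarrow>
           process_law M X = process_law M' X') \<and>
        (\<forall>M F Z X. weak_solution b \<sigma> M\<^sub>0 Z\<^sub>0 \<eta> M F Z X \<longrightarrow> (\<forall>t\<ge>0. law M (X t) \<in> P1)))"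

text \<open>\<open>law_at b \<sigma> M\<^sub>0 Z\<^sub>0 t \<eta>\<close> is \<open>P\<^sub>t\<^sup>* \<eta>\<close>; it is only meaningful for \<open>\<eta>\<close> in \<^const>\<open>P1\<close>, \<open>t \<ge> 0\<close> and a
  well-posed equation.\<close>

definition law_at ::
    "(real^'d \<Rightarrow> (real^'d) measure \<Rightarrow> real^'d) \<Rightarrow> (real^'d \<Rightarrow> (real^'d) measure \<Rightarrow> real^'n^'d) \<Rightarrow>
     'w measure \<Rightarrow> (real \<Rightarrow> 'w \<Rightarrow> real^'n) \<Rightarrow> real \<Rightarrow> (real^'d) measure \<Rightarrow> (real^'d) measure" where
  "law_at b \<sigma> M\<^sub>0 Z\<^sub>0 t \<eta> =
     (THE \<rho>. \<exists>M F Z X. weak_solution b \<sigma> M\<^sub>0 Z\<^sub>0 \<eta> M F Z X \<and> \<rho> = law M (X t))"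

definition invariant_measure ::
    "(real \<Rightarrow> 'a::euclidean_space measure \<Rightarrow> 'a measure) \<Rightarrow> 'a measure \<Rightarrow> bool" where
  "invariant_measure P \<nu> \<longleftrightarrow> \<nu> \<in> P1 \<and> (\<forall>t\<ge>0. P t \<nu> = \<nu>)"

definition frozen :: "('a \<Rightarrow> 'm \<Rightarrow> 'b) \<Rightarrow> 'm \<Rightarrow> 'a \<Rightarrow> 'm \<Rightarrow> 'b" where
  "frozen f \<mu> = (\<lambda>x _. f x \<mu>)"

abbreviation decoupled_law_at ::
    "(real^'d \<Rightarrow> (real^'d) measure \<Rightarrow> real^'d) \<Rightarrow> (real^'d \<Rightarrow> (real^'d) measure \<Rightarrow> real^'n^'d) \<Rightarrow>
     'w measure \<Rightarrow> (real \<Rightarrow> 'w \<Rightarrow> real^'n) \<Rightarrow> (real^'d) measure \<Rightarrow>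
     real \<Rightarrow> (real^'d) measure \<Rightarrow> (real^'d) measure" where
  "decoupled_law_at b \<sigma> M\<^sub>0 Z\<^sub>0 \<mu> \<equiv> law_at (frozen b \<mu>) (frozen \<sigma> \<mu>) M\<^sub>0 Z\<^sub>0"

end

theory Submission
  imports Defs
begin

text \<open>Write \<open>\<Gamma>\<close>, \<open>\<Gamma>'\<close> for the values of \<open>\<Gamma>\<close> at \<open>\<mu>\<close>, \<open>\<mu>'\<close>. For (i), the triangle inequality through
  \<open>(P\<^sub>t\<^sup>\<mu>)\<^sup>* \<Gamma>'\<close> gives \<open>W1 \<Gamma> \<Gamma>' \<le> c\<^sub>0 exp (- \<lambda>\<^sub>0 t) W1 \<Gamma> \<Gamma>' + G t W1 \<mu> \<mu>'\<close>, so for a suitable \<open>t\<close> the map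
  \<open>\<Gamma>\<close> is a contraction of the complete metric space \<open>(P1, W1)\<close>. Its fixed points are the invariant
  measures of the McKean--Vlasov equation, because a process whose marginal laws are constantly \<open>\<mu>\<close>
  solves that equation iff it solves the equation frozen at \<open>\<mu>\<close>. For (ii), the triangle inequality
  through \<open>(P\<^sub>t\<^sup>\<nu>)\<^sup>* \<eta>\<close> shows that \<open>P\<^sub>t\<^sup>*\<close> at time \<open>t\<^sub>1\<close> contracts towards \<open>\<nu>\<close>, and the semigroup property,
  which follows from uniqueness in law and from shifting a solution in time, iterates this.

  Both the triangle inequality and the completeness of \<open>W1\<close> come from one construction: a Markov
  chain that realizes a given sequence of couplings on a single probability space.\<close>

section \<open>Gluing couplings\<close>

text \<open>The gluing is only approximate: consecutive couplings share a marginal in law, but on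
  the common space its two copies are merely within \<open>\<delta> n\<close> of each other almost
  surely. Nothing is lost, because \<open>W1\<close> is an infimum approached with slack anyway and
  no optimal coupling is used. In the triangle inequality the gaps vanish in an epsilon, in the
  completeness proof they form a convergent series.

  The ratio in (i) is \<open>G t / (1 - c\<^sub>0 * exp (- lam\<^sub>0 * t))\<close>: one term of
  the triangle estimate contains the unknown distance itself and is moved to the left. This requires
  a finite distance, supplied by the first moments, and
  \<open>c\<^sub>0 * exp (- lam\<^sub>0 * t) < 1\<close>, which is the restriction on
  \<open>t\<close> under the infimum.

  On the stochastic side the integral is available only as an inductively closed relation. Every
  property of it is checked for elementary integrands and carried through dominated limits, and
  replacing an integrand by one that agrees at positive times is itself an application of the
  closure rule.\<close>

lemma markov_chain_exists:
  fixes N :: "'s measure" and K :: "nat \<Rightarrow> 's \<Rightarrow> 's measure"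
  assumes \<mu>: "\<mu> \<in> space (prob_algebra N)"
    and K: "\<And>n. K n \<in> N \<rightarrow>\<^sub>M prob_algebra N"
  obtains Q where "prob_space Q" "sets Q = sets (Pi\<^sub>M UNIV (\<lambda>_::nat. N))"
    "distr Q N (\<lambda>\<omega>. \<omega> 0) = \<mu>"
    "\<And>n f. f \<in> borel_measurable (N \<Otimes>\<^sub>M N) \<Longrightarrow>
       (\<integral>\<^sup>+\<omega>. f (\<omega> n, \<omega> (Suc n)) \<partial>Q) = (\<integral>\<^sup>+x. (\<integral>\<^sup>+y. f (x, y) \<partial>K n x) \<partial>distr Q N (\<lambda>\<omega>. \<omega> n))"
proof -
  \<comment> \<open>Ionescu-Tulcea feeds coordinate \<open>i\<close> with the whole history
    \<open>{0..<i}\<close>; the Markov property is that the kernel reads only the last entry.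
    Coordinate \<open>0\<close> has an empty history and the constant law \<mu>, so
    \<open>K n\<close> drives coordinate \<open>Suc n\<close>.\<close>
  define P where "P i = (case i of 0 \<Rightarrow> (\<lambda>_. \<mu>) | Suc n \<Rightarrow> (\<lambda>\<omega>. K n (\<omega> n)))" for i :: nat
  have PM: "P i \<in> Pi\<^sub>M {0..<i} (\<lambda>_. N) \<rightarrow>\<^sub>M prob_algebra N" for i
  proof (cases i)
    case 0
    then show ?thesis using \<mu> by (simp add: P_def)
  next
    case (Suc n)
    have "(\<lambda>\<omega>. \<omega> n) \<in> Pi\<^sub>M {0..<Suc n} (\<lambda>_. N) \<rightarrow>\<^sub>M N"
      by (rule measurable_component_singleton) auto
    from measurable_compose[OF this K[of n]] show ?thesis
      by (simp add: P_def Suc)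
  qed
  have "Ionescu_Tulcea P (\<lambda>_. N)"
  proof (rule Ionescu_Tulcea.intro)
    show "\<And>i. P i \<in> Pi\<^sub>M {0..<i} (\<lambda>_. N) \<rightarrow>\<^sub>M subprob_algebra N"
      using PM by (rule measurable_prob_algebraD)
    show "\<And>i x. x \<in> space (Pi\<^sub>M {0..<i} (\<lambda>_. N)) \<Longrightarrow> prob_space (P i x)"
      using measurable_space[OF PM] by (simp add: space_prob_algebra)
  qed
  then interpret IT: Ionescu_Tulcea P "\<lambda>_. N" .
  define Q where "Q = IT.PF.lim"
  have sQ[measurable_cong]: "sets Q = sets (Pi\<^sub>M UNIV (\<lambda>_::nat. N))"
    unfolding Q_def by simp
  \<comment> \<open>The total mass is read off from the marginal on the empty index set.\<close>
  have pQ: "prob_space Q"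
  proof (rule prob_space_distrD)
    show "(\<lambda>\<omega>. restrict \<omega> {}) \<in> Q \<rightarrow>\<^sub>M Pi\<^sub>M {} (\<lambda>_. N)"
      by (simp add: measurable_cong_sets[OF sQ refl] measurable_restrict_subset)
    show "prob_space (distr Q (Pi\<^sub>M {} (\<lambda>_. N)) (\<lambda>\<omega>. restrict \<omega> {}))"
      unfolding Q_def by (subst IT.distr_lim) (auto intro: IT.PF.prob_space_P)
  qed
  have up: "IT.up_to {0..<n} = n" for n
  proof -
    have "IT.up_to {0..<n} \<le> m \<longleftrightarrow> n \<le> m" for m
      by (auto simp: IT.up_to_iff)
    then show ?thesis by (metis order.antisym order_refl)
  qed
  have C: "IT.C 0 n (\<lambda>_. undefined) = distr Q (Pi\<^sub>M {0..<n} (\<lambda>_. N)) (\<lambda>\<omega>. restrict \<omega> {0..<n})" for n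
  proof -
    have "distr Q (Pi\<^sub>M {0..<n} (\<lambda>_. N)) (\<lambda>\<omega>. restrict \<omega> {0..<n}) = IT.CI {0..<n}"
      unfolding Q_def by (rule IT.distr_lim) simp
    also have "\<dots> = IT.C 0 n (\<lambda>_. undefined)"
      unfolding IT.CI_def up using IT.distr_C[of n n "\<lambda>_. undefined" 0] by simp
    finally show ?thesis by simp
  qed
  \<comment> \<open>The newest coordinate is integrated out; the initial law and the joint law of
    two consecutive coordinates both reduce to this recursion.\<close>
  have step: "(\<integral>\<^sup>+\<omega>. g (restrict \<omega> {0..<Suc n}) \<partial>Q) = (\<integral>\<^sup>+\<omega>. (\<integral>\<^sup>+x. g ((restrict \<omega> {0..<n})(n := x)) \<partial>P n (restrict \<omega> {0..<n})) \<partial>Q)"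
    if g[measurable]: "g \<in> borel_measurable (Pi\<^sub>M {0..<Suc n} (\<lambda>_. N))" for g n
  proof -
    have r[measurable]: "(\<lambda>\<omega>. restrict \<omega> {0..<m}) \<in> Q \<rightarrow>\<^sub>M Pi\<^sub>M {0..<m} (\<lambda>_. N)" for m
      by (simp add: measurable_cong_sets[OF sQ refl] measurable_restrict_subset)
    have "(\<integral>\<^sup>+\<omega>. g (restrict \<omega> {0..<Suc n}) \<partial>Q) = (\<integral>\<^sup>+\<omega>. g \<omega> \<partial>IT.C 0 (Suc n) (\<lambda>_. undefined))"
      unfolding C by (subst nn_integral_distr) auto
    also have "\<dots> = (\<integral>\<^sup>+\<omega>. (\<integral>\<^sup>+x. g x \<partial>IT.eP n \<omega>) \<partial>IT.C 0 n (\<lambda>_. undefined))"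
      unfolding IT.C.simps
      by (subst nn_integral_bind[where B="Pi\<^sub>M {0..<Suc n} (\<lambda>_. N)"])
        (auto simp: measurable_cong_sets[OF IT.sets_C refl])
    also have "\<dots> = (\<integral>\<^sup>+\<omega>. (\<integral>\<^sup>+x. g (fun_upd \<omega> n x) \<partial>P n \<omega>) \<partial>IT.C 0 n (\<lambda>_. undefined))"
      by (intro nn_integral_cong IT.nn_integral_eP) (auto simp: IT.space_C)
    also have "\<dots> = (\<integral>\<^sup>+\<omega>. (\<integral>\<^sup>+x. g ((restrict \<omega> {0..<n})(n := x)) \<partial>P n (restrict \<omega> {0..<n})) \<partial>Q)"
    proof -
      have "(\<lambda>\<omega>. \<integral>\<^sup>+x. g (fun_upd \<omega> n x) \<partial>P n \<omega>) \<in> borel_measurable (Pi\<^sub>M {0..<n} (\<lambda>_. N))"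
        by (rule nn_integral_measurable_subprob_algebra2[OF _ IT.P])
          (auto intro!: measurable_compose[OF _ g] measurable_fun_upd[where J="{0..<n}"] simp: measurable_split_conv)
      then show ?thesis unfolding C by (subst nn_integral_distr) auto
    qed
    finally show ?thesis .
  qed
  have c[measurable]: "(\<lambda>\<omega>. \<omega> n) \<in> Q \<rightarrow>\<^sub>M N" for n
    by (simp add: measurable_cong_sets[OF sQ refl] measurable_component_singleton)
  show ?thesis
  proof
    show "prob_space Q" "sets Q = sets (Pi\<^sub>M UNIV (\<lambda>_::nat. N))" by fact+
    show "distr Q N (\<lambda>\<omega>. \<omega> 0) = \<mu>"
    proof (rule measure_eqI)
      show "sets (distr Q N (\<lambda>\<omega>. \<omega> 0)) = sets \<mu>" using \<mu> by (simp add: space_prob_algebra)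
      fix A assume "A \<in> sets (distr Q N (\<lambda>\<omega>. \<omega> 0))"
      then have [measurable]: "A \<in> sets N" by simp
      have "emeasure (distr Q N (\<lambda>\<omega>. \<omega> 0)) A = (\<integral>\<^sup>+\<omega>. indicator A ((restrict \<omega> {0..<Suc 0}) 0) \<partial>Q)"
        by (subst nn_integral_indicator[symmetric]) (simp_all add: nn_integral_distr del: nn_integral_indicator)
      also have "\<dots> = (\<integral>\<^sup>+\<omega>. (\<integral>\<^sup>+x. indicator A x \<partial>\<mu>) \<partial>Q)"
        by (subst step[where g="\<lambda>\<omega>. indicator A (\<omega> 0)"]) (auto simp: P_def)
      also have "\<dots> = emeasure \<mu> A"
        using \<mu> prob_space.emeasure_space_1[OF pQ] by (simp add: space_prob_algebra)
      finally show "emeasure (distr Q N (\<lambda>\<omega>. \<omega> 0)) A = emeasure \<mu> A" .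
    qed
    fix n and f :: "'s \<times> 's \<Rightarrow> ennreal" assume f[measurable]: "f \<in> borel_measurable (N \<Otimes>\<^sub>M N)"
    have "(\<integral>\<^sup>+\<omega>. f (\<omega> n, \<omega> (Suc n)) \<partial>Q) = (\<integral>\<^sup>+\<omega>. (\<lambda>\<omega>. f (\<omega> n, \<omega> (Suc n))) (restrict \<omega> {0..<Suc (Suc n)}) \<partial>Q)"
      by simp
    also have "\<dots> = (\<integral>\<^sup>+\<omega>. (\<integral>\<^sup>+x. f (\<omega> n, x) \<partial>K n (\<omega> n)) \<partial>Q)"
      by (subst step) (auto simp: P_def)
    also have "\<dots> = (\<integral>\<^sup>+x. (\<integral>\<^sup>+y. f (x, y) \<partial>K n x) \<partial>distr Q N (\<lambda>\<omega>. \<omega> n))"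
    proof -
      have "(\<lambda>x. \<integral>\<^sup>+y. f (x, y) \<partial>K n x) \<in> borel_measurable N"
        by (rule nn_integral_measurable_subprob_algebra2[OF _ measurable_prob_algebraD[OF K]]) simp
      then show ?thesis by (subst nn_integral_distr) auto
    qed
    finally show "(\<integral>\<^sup>+\<omega>. f (\<omega> n, \<omega> (Suc n)) \<partial>Q) = \<dots>" .
  qed
qed

section \<open>Conditioning on countably many small cells\<close>

lemma small_cells_exist:
  fixes \<delta> :: real
  assumes "\<delta> > 0"
  obtains q :: "'a::{metric_space, second_countable_topology} \<Rightarrow> nat"
  where "q \<in> borel \<rightarrow>\<^sub>M count_space UNIV" "\<And>x y. q x = q y \<Longrightarrow> dist x y \<le> \<delta>"
proof -
  obtain D :: "'a set" where D: "countable D" "\<And>X. open X \<Longrightarrow> X \<noteq> {} \<Longrightarrow> \<exists>d\<in>D. d \<in> X"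
    using countable_dense_setE by blast
  then have ne: "D \<noteq> {}" by (metis UNIV_not_empty empty_iff open_UNIV)
  \<comment> \<open>The label of \<open>x\<close> is the index of the first point of a dense
    sequence within \<open>\<delta> / 2\<close>; two points with the same label are compared through
    that point.\<close>
  define q where "q x = (LEAST n. dist x (from_nat_into D n) < \<delta> / 2)" for x
  have "\<exists>n. dist x (from_nat_into D n) < \<delta> / 2" for x
  proof -
    have "ball x (\<delta> / 2) \<noteq> {}" using assms by simp
    then obtain d where "d \<in> D" "d \<in> ball x (\<delta> / 2)" using D(2)[OF open_ball] by blast
    then show ?thesis using from_nat_into_surj[OF D(1)] by (metis mem_ball)
  qed
  then have q: "dist x (from_nat_into D (q x)) < \<delta> / 2" for x
    unfolding q_def by (rule LeastI_ex)
  show ?thesis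
  proof
    show "q \<in> borel \<rightarrow>\<^sub>M count_space UNIV" unfolding q_def by measurable
    show "dist x y \<le> \<delta>" if "q x = q y" for x y
      using q[of x] q[of y] dist_triangle2[of x y "from_nat_into D (q x)"] that by simp
  qed
qed

text \<open>Elementary conditional law of \<pi> given \<open>r = i\<close>. A null cell has none;
  falling back on \<pi> keeps every value a probability measure, so that labels are mapped to
  measures by a total Markov kernel.\<close>

definition cell_cond :: "'s measure \<Rightarrow> ('s \<Rightarrow> nat) \<Rightarrow> nat \<Rightarrow> 's measure" where
  "cell_cond \<pi> r i = (let A = {w \<in> space \<pi>. r w = i} in
     if emeasure \<pi> A = 0 then \<pi> else uniform_measure \<pi> A)"

context prob_space
begin

lemma cell_cond_in_prob_algebra: "cell_cond M r i \<in> space (prob_algebra M)"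
  by (auto simp: cell_cond_def Let_def space_prob_algebra prob_space_axioms
      intro!: prob_space_uniform_measure)

lemma AE_cell_cond:
  assumes [measurable]: "r \<in> M \<rightarrow>\<^sub>M count_space UNIV"
    and "emeasure M {w \<in> space M. r w = i} \<noteq> 0"
  shows "AE y in cell_cond M r i. r y = i"
proof -
  have eq: "cell_cond M r i = uniform_measure M {w \<in> space M. r w = i}"
    using assms(2) unfolding cell_cond_def Let_def by (rule if_not_P)
  show ?thesis
    unfolding eq by (intro AE_uniform_measureI) auto
qed

lemma nn_integral_cells:
  assumes [measurable]: "r \<in> M \<rightarrow>\<^sub>M count_space UNIV" "h \<in> borel_measurable M"
  shows "(\<integral>\<^sup>+w. h w \<partial>M) = (\<Sum>i. \<integral>\<^sup>+w. h w * indicator {w \<in> space M. r w = i} w \<partial>M)"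
proof -
  have "(\<Sum>i. h w * indicator {w \<in> space M. r w = i} w) = h w" if "w \<in> space M" for w
    using that by (subst suminf_finite[of "{r w}"]) auto
  then have "(\<integral>\<^sup>+w. h w \<partial>M) = (\<integral>\<^sup>+w. (\<Sum>i. h w * indicator {w \<in> space M. r w = i} w) \<partial>M)"
    by (intro nn_integral_cong) simp
  also have "\<dots> = (\<Sum>i. \<integral>\<^sup>+w. h w * indicator {w \<in> space M. r w = i} w \<partial>M)"
    by (rule nn_integral_suminf) measurable
  finally show ?thesis .
qed

text \<open>Law of total probability: the label \<open>s\<close> under \<open>N\<close> selects each
  cell with the probability that \<open>r\<close> gives it under \<open>M\<close>, so averaging the
  conditional laws restores \<open>M\<close>. This keeps every pair in the glued chain distributed
  as prescribed.\<close>

lemma nn_integral_cell_cond: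
  assumes r[measurable]: "r \<in> M \<rightarrow>\<^sub>M count_space UNIV" and f[measurable]: "f \<in> borel_measurable M"
    and s[measurable]: "s \<in> N \<rightarrow>\<^sub>M count_space UNIV"
    and eq: "distr N (count_space UNIV) s = distr M (count_space UNIV) r"
  shows "(\<integral>\<^sup>+x. (\<integral>\<^sup>+y. f y \<partial>cell_cond M r (s x)) \<partial>N) = (\<integral>\<^sup>+y. f y \<partial>M)"
proof -
  let ?A = "\<lambda>i. {w \<in> space M. r w = i}"
  define g where "g i = (\<integral>\<^sup>+y. f y \<partial>cell_cond M r i)" for i
  \<comment> \<open>On a null cell both sides vanish, so the fallback value of
    \<open>cell_cond\<close> is multiplied by zero.\<close>
  have g: "g i * emeasure M (?A i) = (\<integral>\<^sup>+w. f w * indicator (?A i) w \<partial>M)" for i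
  proof (cases "emeasure M (?A i) = 0")
    case True
    have "(\<integral>\<^sup>+w. f w * indicator (?A i) w \<partial>M) = 0"
      using True by (subst nn_integral_0_iff_AE)
        (auto simp: null_sets_def indicator_eq_0_iff intro!: AE_I'[of "?A i"])
    then show ?thesis using True by simp
  next
    case False
    moreover have "emeasure M (?A i) / emeasure M (?A i) = 1"
      using False by (intro ennreal_divide_self) (auto simp: emeasure_eq_measure)
    ultimately show ?thesis
      by (simp add: g_def cell_cond_def Let_def nn_integral_uniform_measure ennreal_divide_times)
  qed
  have "(\<integral>\<^sup>+x. g (s x) \<partial>N) = (\<integral>\<^sup>+i. g i \<partial>distr N (count_space UNIV) s)"
    by (simp add: nn_integral_distr)
  also have "\<dots> = (\<integral>\<^sup>+w. g (r w) \<partial>M)"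
    by (simp add: eq nn_integral_distr)
  also have "\<dots> = (\<Sum>i. \<integral>\<^sup>+w. g (r w) * indicator (?A i) w \<partial>M)"
    by (rule nn_integral_cells) (auto intro: measurable_compose[OF r])
  also have "\<dots> = (\<Sum>i. \<integral>\<^sup>+w. g i * indicator (?A i) w \<partial>M)"
    by (intro suminf_cong nn_integral_cong) (auto simp: indicator_def)
  also have "\<dots> = (\<Sum>i. \<integral>\<^sup>+w. f w * indicator (?A i) w \<partial>M)"
    by (intro suminf_cong) (simp add: nn_integral_cmult_indicator g)
  also have "\<dots> = (\<integral>\<^sup>+y. f y \<partial>M)"
    by (rule nn_integral_cells[symmetric]) auto
  finally show ?thesis by (simp add: g_def)
qed

end

text \<open>Consecutive couplings are glued without disintegration: the next pair is drawn from
  \<open>\<pi> (Suc n)\<close> conditioned on its first component lying in the same small cell as the current second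
  component. There are countably many cells, so this is elementary conditioning, and both
  components have the law \<open>\<mu> (Suc n)\<close>, so the conditioned pair again has law \<open>\<pi> (Suc n)\<close>.\<close>

lemma glue_couplings:
  fixes \<mu> :: "nat \<Rightarrow> 'a::euclidean_space measure" and \<delta> :: "nat \<Rightarrow> real"
  assumes \<pi>: "\<And>n. \<pi> n \<in> couplings (\<mu> n) (\<mu> (Suc n))" and \<delta>: "\<And>n. \<delta> n > 0"
  obtains Q :: "(nat \<Rightarrow> 'a \<times> 'a) measure" and X Y :: "nat \<Rightarrow> (nat \<Rightarrow> 'a \<times> 'a) \<Rightarrow> 'a"
  where "prob_space Q" "\<And>n. X n \<in> borel_measurable Q" "\<And>n. Y n \<in> borel_measurable Q"
    "\<And>n. distr Q borel (\<lambda>\<omega>. (X n \<omega>, Y n \<omega>)) = \<pi> n"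
    "\<And>n. AE \<omega> in Q. dist (Y n \<omega>) (X (Suc n) \<omega>) \<le> \<delta> n"
proof -
  have "\<exists>q. (q :: 'a \<Rightarrow> nat) \<in> borel \<rightarrow>\<^sub>M count_space UNIV \<and> (\<forall>x y. q x = q y \<longrightarrow> dist x y \<le> \<delta> n)" for n
    using small_cells_exist[OF \<delta>[of n]] by metis
  then obtain q :: "nat \<Rightarrow> 'a \<Rightarrow> nat" where q[measurable]: "\<And>n. q n \<in> borel \<rightarrow>\<^sub>M count_space UNIV"
    and q_dist: "\<And>n x y. q n x = q n y \<Longrightarrow> dist x y \<le> \<delta> n"
    by metis
  have prob_\<pi>: "prob_space (\<pi> n)" and sets_\<pi>: "sets (\<pi> n) = sets borel"
    and fst_\<pi>: "distr (\<pi> n) borel fst = \<mu> n" and snd_\<pi>: "distr (\<pi> n) borel snd = \<mu> (Suc n)" for n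
    using \<pi>[of n] by (auto simp: couplings_def prob_measures_def)
  note [measurable_cong] = sets_\<pi>
  note [simp] = sets_eq_imp_space_eq[OF sets_\<pi>]
  have fs[measurable]: "fst \<in> borel_measurable (borel :: ('a \<times> 'a) measure)"
    "snd \<in> borel_measurable (borel :: ('a \<times> 'a) measure)"
    by (simp_all flip: borel_prod)
  have [measurable]: "fst \<in> borel_measurable (\<pi> n)" "snd \<in> borel_measurable (\<pi> n)" for n by measurable
  have meas_\<pi>: "(f \<in> \<pi> n \<rightarrow>\<^sub>M N) = (f \<in> borel \<rightarrow>\<^sub>M N)"
    for n and f :: "'a \<times> 'a \<Rightarrow> 'c" and N :: "'c measure"
    by (simp add: measurable_cong_sets[OF sets_\<pi> refl])
  have q_snd: "(\<lambda>w :: 'a \<times> 'a. q n (snd w)) \<in> borel \<rightarrow>\<^sub>M count_space UNIV" for n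
    by (rule measurable_compose[OF fs(2) q])
  define r :: "nat \<Rightarrow> 'a \<times> 'a \<Rightarrow> nat" where "r n = q n \<circ> fst" for n
  have r[measurable]: "r n \<in> borel \<rightarrow>\<^sub>M count_space UNIV" for n
    unfolding r_def comp_def by (rule measurable_compose[OF fs(1) q])
  define K :: "nat \<Rightarrow> 'a \<times> 'a \<Rightarrow> ('a \<times> 'a) measure"
    where "K n w = cell_cond (\<pi> (Suc n)) (r n) (q n (snd w))" for n w
  have in_alg: "cell_cond (\<pi> (Suc n)) (r n) i \<in> space (prob_algebra borel)" for n i
    using prob_space.cell_cond_in_prob_algebra[OF prob_\<pi>] by (simp add: space_prob_algebra sets_\<pi>)
  \<comment> \<open>The kernel factors through the discrete space of labels, where only membership
    of the values in the probability algebra has to be checked.\<close>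
  have K_meas: "K n \<in> borel \<rightarrow>\<^sub>M prob_algebra borel" for n
    unfolding K_def
    by (rule measurable_compose[of "\<lambda>w. q n (snd w)" _ "count_space UNIV"]) (measurable, simp add: in_alg)
  have \<pi>0: "\<pi> 0 \<in> space (prob_algebra borel)"
    by (simp add: space_prob_algebra prob_\<pi> sets_\<pi>)
  obtain Q :: "(nat \<Rightarrow> 'a \<times> 'a) measure" where pQ: "prob_space Q"
    and sQ[measurable_cong]: "sets Q = sets (Pi\<^sub>M UNIV (\<lambda>_. borel))"
    and Q0: "distr Q borel (\<lambda>\<omega>. \<omega> 0) = \<pi> 0"
    and step: "\<And>n f. f \<in> borel_measurable (borel \<Otimes>\<^sub>M borel) \<Longrightarrow>
       (\<integral>\<^sup>+\<omega>. f (\<omega> n, \<omega> (Suc n)) \<partial>Q) = (\<integral>\<^sup>+x. (\<integral>\<^sup>+y. f (x, y) \<partial>K n x) \<partial>distr Q borel (\<lambda>\<omega>. \<omega> n))"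
    by (rule markov_chain_exists[of "\<pi> 0" borel K, OF \<pi>0 K_meas]) (rule that)
  have c[measurable]: "(\<lambda>\<omega>. \<omega> n) \<in> borel_measurable Q" for n
    by (simp add: measurable_cong_sets[OF sQ refl] measurable_component_singleton)
  have same_cells: "distr (\<pi> n) (count_space UNIV) (\<lambda>w. q n (snd w)) = distr (\<pi> (Suc n)) (count_space UNIV) (r n)" for n
  proof -
    have "distr (\<pi> n) (count_space UNIV) (\<lambda>w. q n (snd w)) = distr (distr (\<pi> n) borel snd) (count_space UNIV) (q n)"
      by (simp add: distr_distr comp_def)
    also have "\<dots> = distr (distr (\<pi> (Suc n)) borel fst) (count_space UNIV) (q n)"
      by (simp add: snd_\<pi> fst_\<pi>)
    also have "\<dots> = distr (\<pi> (Suc n)) (count_space UNIV) (r n)"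
      by (simp add: distr_distr r_def)
    finally show ?thesis .
  qed
  have law: "distr Q borel (\<lambda>\<omega>. \<omega> n) = \<pi> n" for n
  proof (induction n)
    case (Suc n)
    show ?case
    proof (rule measure_eqI)
      fix A assume "A \<in> sets (distr Q borel (\<lambda>\<omega>. \<omega> (Suc n)))"
      then have A[measurable]: "A \<in> sets borel" by simp
      have "emeasure (distr Q borel (\<lambda>\<omega>. \<omega> (Suc n))) A = (\<integral>\<^sup>+\<omega>. indicator A (\<omega> (Suc n)) \<partial>Q)"
        by (subst nn_integral_indicator[symmetric]) (simp_all add: nn_integral_distr del: nn_integral_indicator)
      also have "\<dots> = (\<integral>\<^sup>+x. (\<integral>\<^sup>+y. indicator A y \<partial>K n x) \<partial>\<pi> n)"
        using step[of "\<lambda>w. indicator A (snd w)" n] by (simp add: Suc)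
      also have "\<dots> = (\<integral>\<^sup>+y. indicator A y \<partial>\<pi> (Suc n))"
        unfolding K_def
        by (rule prob_space.nn_integral_cell_cond[OF prob_\<pi> _ _ _ same_cells])
          (simp_all add: meas_\<pi> q_snd)
      also have "\<dots> = emeasure (\<pi> (Suc n)) A" by (simp add: sets_\<pi>)
      finally show "emeasure (distr Q borel (\<lambda>\<omega>. \<omega> (Suc n))) A = emeasure (\<pi> (Suc n)) A" .
    qed (simp add: sets_\<pi>)
  qed (rule Q0)
  have close: "AE \<omega> in Q. q n (snd (\<omega> n)) = q n (fst (\<omega> (Suc n)))" for n
  proof -
    \<comment> \<open>This marks the transitions with mismatched labels; its integral over one step
      of the chain turns out to be zero.\<close>
    define f :: "('a \<times> 'a) \<times> ('a \<times> 'a) \<Rightarrow> ennreal"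
      where "f = indicator {w. q n (snd (fst w)) \<noteq> q n (fst (snd w))}"
    let ?B = "borel \<Otimes>\<^sub>M borel :: (('a \<times> 'a) \<times> ('a \<times> 'a)) measure"
    have f: "f \<in> borel_measurable (?B)"
    proof -
      have [measurable]: "(\<lambda>w. q n (snd (fst w))) \<in> ?B \<rightarrow>\<^sub>M count_space UNIV"
        "(\<lambda>w. q n (fst (snd w))) \<in> ?B \<rightarrow>\<^sub>M count_space UNIV"
        using measurable_compose[OF measurable_fst q_snd] measurable_compose[OF measurable_snd r]
        by (simp_all add: r_def comp_def)
      have "{w \<in> space (?B). \<exists>i. q n (snd (fst w)) = i \<and> q n (fst (snd w)) = i} \<in> sets (?B)"
        by measurable
      then have "{w. q n (snd (fst w)) = q n (fst (snd w))} \<in> sets (?B)"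
        by (simp add: space_pair_measure eq_commute)
      then have "space (?B) - {w. q n (snd (fst w)) = q n (fst (snd w))} \<in> sets (?B)"
        by (rule sets.compl_sets)
      then show ?thesis
        unfolding f_def by (intro borel_measurable_indicator) (simp add: space_pair_measure Diff_eq Collect_neg_eq)
    qed
    \<comment> \<open>Conditioning enforces matching labels only on cells of positive mass. There
      are countably many null cells, so almost surely the chain never asks for one; by
      \<open>same_cells\<close> this can be checked under \<open>\<pi> (Suc n)\<close>
      itself.\<close>
    have null: "AE x in \<pi> n. emeasure (\<pi> (Suc n)) {w. r n w = q n (snd x)} \<noteq> 0"
    proof -
      have "AE i in distr (\<pi> n) (count_space UNIV) (\<lambda>w. q n (snd w)). emeasure (\<pi> (Suc n)) {w. r n w = i} \<noteq> 0"
        unfolding same_cells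
      proof (subst AE_distr_iff)
        have "AE w in \<pi> (Suc n). \<forall>i. emeasure (\<pi> (Suc n)) {w. r n w = i} = 0 \<longrightarrow> r n w \<noteq> i"
          unfolding AE_all_countable
          by (auto intro!: AE_I'[where N="{w. r n w = i}" for i] simp: null_sets_def sets_\<pi>)
        then show "AE w in \<pi> (Suc n). emeasure (\<pi> (Suc n)) {w'. r n w' = r n w} \<noteq> 0" by eventually_elim auto
      qed (auto simp: meas_\<pi>)
      then show ?thesis by (subst (asm) AE_distr_iff) (auto simp: meas_\<pi> q_snd)
    qed
    have "(\<integral>\<^sup>+\<omega>. f (\<omega> n, \<omega> (Suc n)) \<partial>Q) = (\<integral>\<^sup>+x. (\<integral>\<^sup>+y. f (x, y) \<partial>K n x) \<partial>\<pi> n)"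
      using step[OF f, of n] by (simp add: law)
    also have "\<dots> = (\<integral>\<^sup>+x. 0 \<partial>\<pi> n)"
    proof (rule nn_integral_cong_AE)
      show "AE x in \<pi> n. (\<integral>\<^sup>+y. f (x, y) \<partial>K n x) = 0"
        using null
      proof eventually_elim
        case (elim x)
        have "AE y in K n x. r n y = q n (snd x)"
          unfolding K_def by (rule prob_space.AE_cell_cond[OF prob_\<pi>]) (use elim in \<open>auto simp: meas_\<pi>\<close>)
        then have "AE y in K n x. f (x, y) = 0"
          by eventually_elim (simp add: f_def r_def)
        then show ?case
          by (subst nn_integral_cong_AE[where v="\<lambda>_. 0"]) auto
      qed
    qed
    finally have "(\<integral>\<^sup>+\<omega>. f (\<omega> n, \<omega> (Suc n)) \<partial>Q) = 0" by simp
    moreover have "(\<lambda>\<omega>. f (\<omega> n, \<omega> (Suc n))) \<in> borel_measurable Q"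
      by (rule measurable_compose[OF _ f]) measurable
    ultimately have "AE \<omega> in Q. f (\<omega> n, \<omega> (Suc n)) = 0"
      by (subst (asm) nn_integral_0_iff_AE)
    then show ?thesis by eventually_elim (simp add: f_def indicator_def split: if_splits)
  qed
  show ?thesis
  proof (rule that)
    show "prob_space Q" by fact
    show "(\<lambda>\<omega>. fst (\<omega> n)) \<in> borel_measurable Q" "(\<lambda>\<omega>. snd (\<omega> n)) \<in> borel_measurable Q" for n by measurable
    show "distr Q borel (\<lambda>\<omega>. (fst (\<omega> n), snd (\<omega> n))) = \<pi> n" for n by (simp add: law)
    show "AE \<omega> in Q. dist (snd (\<omega> n)) (fst (\<omega> (Suc n))) \<le> \<delta> n" for n
      using close by eventually_elim (rule q_dist)
  qed
qed

section \<open>The Wasserstein space\<close>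

lemma borel_measurable_fst_snd [measurable]:
  "fst \<in> borel_measurable (borel :: ('a::second_countable_topology \<times> 'b::second_countable_topology) measure)"
  "snd \<in> borel_measurable (borel :: ('a::second_countable_topology \<times> 'b::second_countable_topology) measure)"
  by (simp_all flip: borel_prod)

lemma couplings_distr:
  assumes "prob_space Q" and XY: "(\<lambda>\<omega>. (X \<omega>, Y \<omega>)) \<in> borel_measurable Q"
  shows "distr Q borel (\<lambda>\<omega>. (X \<omega>, Y \<omega>)) \<in> couplings (distr Q borel X) (distr Q borel Y)"
  using prob_space.prob_space_distr[OF assms]
  by (auto simp: couplings_def prob_measures_def distr_distr[OF _ XY] comp_def)

lemma transport_cost_measurable [measurable]:
  "(\<lambda>(x :: 'a::euclidean_space, y). ennreal (norm (x - y))) \<in> borel_measurable borel"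
  unfolding split_beta' borel_prod[symmetric] by measurable

text \<open>Two random variables on a common probability space induce a coupling of their laws. This
  is the way in which upper bounds on \<open>W1\<close> are obtained: by constructing such a
  pair.\<close>

lemma W1_le:
  assumes "prob_space Q" and [measurable]: "X \<in> borel_measurable Q" "Y \<in> borel_measurable Q"
  shows "W1 (distr Q borel X) (distr Q borel Y) \<le> (\<integral>\<^sup>+\<omega>. ennreal (dist (X \<omega>) (Y \<omega>)) \<partial>Q)"
proof -
  have XY: "(\<lambda>\<omega>. (X \<omega>, Y \<omega>)) \<in> borel_measurable Q" by measurable
  have "W1 (distr Q borel X) (distr Q borel Y) \<le>
      (\<integral>\<^sup>+(x, y). ennreal (norm (x - y)) \<partial>distr Q borel (\<lambda>\<omega>. (X \<omega>, Y \<omega>)))"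
    unfolding W1_def by (rule INF_lower[OF couplings_distr[OF assms(1) XY]])
  also have "\<dots> = (\<integral>\<^sup>+\<omega>. ennreal (dist (X \<omega>) (Y \<omega>)) \<partial>Q)"
    by (subst nn_integral_distr[OF XY]) (simp_all add: transport_cost_measurable dist_norm)
  finally show ?thesis .
qed

lemma couplingsE:
  assumes "\<pi> \<in> couplings \<mu> \<nu>"
  obtains "prob_space \<pi>" "sets \<pi> = sets borel" "distr \<pi> borel fst = \<mu>" "distr \<pi> borel snd = \<nu>"
    "fst \<in> borel_measurable \<pi>" "snd \<in> borel_measurable \<pi>"
proof -
  have s: "sets \<pi> = sets borel" using assms by (simp add: couplings_def prob_measures_def)
  show ?thesis
    using assms
    by (intro that) (auto simp: couplings_def prob_measures_def measurable_cong_sets[OF s refl])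
qed

lemma W1_less_obtains_coupling:
  assumes "W1 \<mu> \<nu> < c"
  obtains \<pi> where "\<pi> \<in> couplings \<mu> \<nu>" "(\<integral>\<^sup>+z. ennreal (dist (fst z) (snd z)) \<partial>\<pi>) < c"
  using assms unfolding W1_def INF_less_iff by (auto simp: dist_norm split_beta')

lemma W1_commute: "W1 \<mu> \<nu> = W1 \<nu> \<mu>"
proof -
  have "W1 \<nu> \<mu> \<le> W1 \<mu> \<nu>" for \<mu> \<nu> :: "'a measure"
  proof (rule ccontr)
    assume "\<not> W1 \<nu> \<mu> \<le> W1 \<mu> \<nu>"
    then obtain \<pi> where \<pi>: "\<pi> \<in> couplings \<mu> \<nu>" "(\<integral>\<^sup>+z. ennreal (dist (fst z) (snd z)) \<partial>\<pi>) < W1 \<nu> \<mu>"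
      using W1_less_obtains_coupling by (metis not_le)
    from \<pi>(1) have "W1 \<nu> \<mu> \<le> (\<integral>\<^sup>+z. ennreal (dist (snd z) (fst z)) \<partial>\<pi>)"
      by (elim couplingsE) (metis W1_le)
    with \<pi>(2) show False by (simp add: dist_commute)
  qed
  then show ?thesis by (simp add: order.antisym)
qed

lemma prob_measures_distr_id: "\<mu> \<in> prob_measures \<Longrightarrow> distr \<mu> borel (\<lambda>x. x) = \<mu>"
  unfolding prob_measures_def by (auto intro: distr_id2)

text \<open>Prolongs a finite list of couplings to the infinite sequence that
  \<open>glue_couplings\<close> expects.\<close>

lemma diagonal_coupling:
  fixes \<mu> :: "'a::euclidean_space measure"
  assumes "\<mu> \<in> prob_measures"
  shows "distr \<mu> borel (\<lambda>x. (x, x)) \<in> couplings \<mu> \<mu>"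
proof -
  have "(\<lambda>x. (x, x)) \<in> borel_measurable \<mu>"
    using assms by (auto simp: prob_measures_def measurable_cong_sets[of \<mu> borel])
  then show ?thesis
    using couplings_distr[of \<mu> "\<lambda>x. x" "\<lambda>x. x"] assms
    by (simp add: prob_measures_distr_id) (simp add: prob_measures_def)
qed

lemma ennreal_less_add_pos:
  fixes x :: ennreal and e :: real
  assumes "x < top" "e > 0"
  shows "x < x + ennreal e"
  using assms by (cases x rule: ennreal_cases) (auto simp flip: ennreal_plus simp: ennreal_less_iff)

text \<open>Near-optimal couplings of the two pairs are glued along \<nu>, and the outer components
  of the result are compared. The assumption on \<rho> supplies the diagonal couplings that continue
  the chain; an infinite right-hand side leaves nothing to show.\<close>

lemma W1_triangle:
  fixes \<mu> \<nu> \<rho> :: "'a::euclidean_space measure"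
  assumes \<rho>: "\<rho> \<in> prob_measures"
  shows "W1 \<mu> \<rho> \<le> W1 \<mu> \<nu> + W1 \<nu> \<rho>"
proof (rule ennreal_le_epsilon)
  fix e :: real assume fin: "W1 \<mu> \<nu> + W1 \<nu> \<rho> < top" and e: "0 < e"
  \<comment> \<open>One third for the excess cost of each coupling, one third for the gap between
    \<open>Y 0\<close> and \<open>X 1\<close>.\<close>
  have lt: "W1 \<mu> \<nu> < W1 \<mu> \<nu> + ennreal (e / 3)" "W1 \<nu> \<rho> < W1 \<nu> \<rho> + ennreal (e / 3)"
    using fin e by (auto intro!: ennreal_less_add_pos)
  obtain \<pi>\<^sub>1 where \<pi>\<^sub>1: "\<pi>\<^sub>1 \<in> couplings \<mu> \<nu>" "(\<integral>\<^sup>+z. ennreal (dist (fst z) (snd z)) \<partial>\<pi>\<^sub>1) < W1 \<mu> \<nu> + ennreal (e / 3)"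
    by (rule W1_less_obtains_coupling[OF lt(1)])
  obtain \<pi>\<^sub>2 where \<pi>\<^sub>2: "\<pi>\<^sub>2 \<in> couplings \<nu> \<rho>" "(\<integral>\<^sup>+z. ennreal (dist (fst z) (snd z)) \<partial>\<pi>\<^sub>2) < W1 \<nu> \<rho> + ennreal (e / 3)"
    by (rule W1_less_obtains_coupling[OF lt(2)])
  define \<pi> where "\<pi> n = (if n = 0 then \<pi>\<^sub>1 else if n = 1 then \<pi>\<^sub>2 else distr \<rho> borel (\<lambda>x. (x, x)))" for n :: nat
  define m where "m n = (if n = 0 then \<mu> else if n = 1 then \<nu> else \<rho>)" for n :: nat
  have cpl: "\<pi> n \<in> couplings (m n) (m (Suc n))" for n
    using \<pi>\<^sub>1(1) \<pi>\<^sub>2(1) diagonal_coupling[OF \<rho>] by (simp add: \<pi>_def m_def)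
  have e3: "e / 3 > 0" using e by simp
  obtain Q :: "(nat \<Rightarrow> 'a \<times> 'a) measure" and X Y where Q: "prob_space Q"
    and [measurable]: "\<And>n. X n \<in> borel_measurable Q" "\<And>n. Y n \<in> borel_measurable Q"
    and XY: "\<And>n. distr Q borel (\<lambda>\<omega>. (X n \<omega>, Y n \<omega>)) = \<pi> n"
    and close: "\<And>n. AE \<omega> in Q. dist (Y n \<omega>) (X (Suc n) \<omega>) \<le> e / 3"
    by (rule glue_couplings[of \<pi> m "\<lambda>_. e / 3", OF cpl e3]) (rule that)
  have X0: "distr Q borel (X 0) = \<mu>" and Y1: "distr Q borel (Y 1) = \<rho>"
  proof -
    have "distr Q borel (X 0) = distr (\<pi> 0) borel fst" "distr Q borel (Y 1) = distr (\<pi> 1) borel snd"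
      unfolding XY[symmetric] by (simp_all add: distr_distr comp_def)
    then show "distr Q borel (X 0) = \<mu>" "distr Q borel (Y 1) = \<rho>"
      using \<pi>\<^sub>1(1) \<pi>\<^sub>2(1) by (auto simp: \<pi>_def couplings_def)
  qed
  have cost: "(\<integral>\<^sup>+\<omega>. ennreal (dist (X n \<omega>) (Y n \<omega>)) \<partial>Q) = (\<integral>\<^sup>+z. ennreal (dist (fst z) (snd z)) \<partial>\<pi> n)" for n
    unfolding XY[symmetric] by (subst nn_integral_distr) simp_all
  have "W1 \<mu> \<rho> \<le> (\<integral>\<^sup>+\<omega>. ennreal (dist (X 0 \<omega>) (Y 1 \<omega>)) \<partial>Q)"
    using W1_le[OF Q, of "X 0" "Y 1"] unfolding X0 Y1 by simp
  also have "\<dots> \<le> (\<integral>\<^sup>+\<omega>. ennreal (dist (X 0 \<omega>) (Y 0 \<omega>)) + ennreal (e / 3) + ennreal (dist (X 1 \<omega>) (Y 1 \<omega>)) \<partial>Q)"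
  proof (rule nn_integral_mono_AE)
    show "AE \<omega> in Q. ennreal (dist (X 0 \<omega>) (Y 1 \<omega>)) \<le> ennreal (dist (X 0 \<omega>) (Y 0 \<omega>)) + ennreal (e / 3) + ennreal (dist (X 1 \<omega>) (Y 1 \<omega>))"
      using close[of 0]
    proof eventually_elim
      case (elim \<omega>)
      then have "dist (X 0 \<omega>) (Y 1 \<omega>) \<le> dist (X 0 \<omega>) (Y 0 \<omega>) + e / 3 + dist (X 1 \<omega>) (Y 1 \<omega>)"
        using dist_triangle[of "X 0 \<omega>" "Y 1 \<omega>" "Y 0 \<omega>"] dist_triangle[of "Y 0 \<omega>" "Y 1 \<omega>" "X 1 \<omega>"] by simp
      then show ?case using e by (simp flip: ennreal_plus add: ennreal_leI)
    qed
  qed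
  also have "\<dots> = (\<integral>\<^sup>+z. ennreal (dist (fst z) (snd z)) \<partial>\<pi>\<^sub>1) + ennreal (e / 3) + (\<integral>\<^sup>+z. ennreal (dist (fst z) (snd z)) \<partial>\<pi>\<^sub>2)"
  proof -
    have "\<pi> 0 = \<pi>\<^sub>1" "\<pi> 1 = \<pi>\<^sub>2" by (simp_all add: \<pi>_def)
    with cost[of 0] cost[of 1] show ?thesis
      by (simp add: nn_integral_add prob_space.emeasure_space_1[OF Q] del: One_nat_def)
  qed
  also have "\<dots> \<le> (W1 \<mu> \<nu> + ennreal (e / 3)) + ennreal (e / 3) + (W1 \<nu> \<rho> + ennreal (e / 3))"
    using \<pi>\<^sub>1(2) \<pi>\<^sub>2(2) by (intro add_mono) auto
  also have "\<dots> = W1 \<mu> \<nu> + W1 \<nu> \<rho> + (ennreal (e / 3) + ennreal (e / 3) + ennreal (e / 3))"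
    by (simp add: ac_simps)
  also have "ennreal (e / 3) + ennreal (e / 3) + ennreal (e / 3) = ennreal e"
    using e by (simp flip: ennreal_plus)
  finally show "W1 \<mu> \<rho> \<le> W1 \<mu> \<nu> + W1 \<nu> \<rho> + ennreal e" .
qed

section \<open>Finite first moments\<close>

lemma P1_prob_measures: "\<mu> \<in> P1 \<Longrightarrow> \<mu> \<in> prob_measures"
  by (simp add: P1_def)

lemma P1_iff: "\<mu> \<in> P1 \<longleftrightarrow> \<mu> \<in> prob_measures \<and> (\<integral>\<^sup>+x. ennreal (norm x) \<partial>\<mu>) < \<infinity>"
proof -
  have "norm \<in> borel_measurable \<mu>" if "\<mu> \<in> prob_measures"
    using that by (auto simp: prob_measures_def measurable_cong_sets[of \<mu> borel])
  then show ?thesis by (auto simp: P1_def integrable_iff_bounded)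
qed

lemma (in prob_space) distr_pair_snd:
  assumes "sigma_finite_measure N"
  shows "distr (M \<Otimes>\<^sub>M N) N snd = N"
proof (rule measure_eqI)
  interpret N: sigma_finite_measure N by fact
  fix A assume "A \<in> sets (distr (M \<Otimes>\<^sub>M N) N snd)"
  then have A: "A \<in> sets N" by simp
  then have "snd -` A \<inter> space (M \<Otimes>\<^sub>M N) = space M \<times> A"
    by (auto simp: space_pair_measure dest: sets.sets_into_space)
  with A show "emeasure (distr (M \<Otimes>\<^sub>M N) N snd) A = emeasure N A"
    by (simp add: emeasure_distr N.emeasure_pair_measure_Times emeasure_space_1)
qed simp

text \<open>The product coupling costs at most the sum of the two first moments. Finiteness is what
  later allows a term containing the unknown distance to be moved across an inequality.\<close>

lemma W1_finite:
  assumes "\<mu> \<in> P1" "\<nu> \<in> P1"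
  shows "W1 \<mu> \<nu> < \<infinity>"
proof -
  have p: "prob_space \<mu>" "prob_space \<nu>" and s: "sets \<mu> = sets borel" "sets \<nu> = sets borel"
    using assms by (auto simp: P1_def prob_measures_def)
  interpret \<mu>: prob_space \<mu> by fact
  interpret \<nu>: prob_space \<nu> by fact
  interpret pair_prob_space \<mu> \<nu> ..
  note [measurable_cong] = s
  let ?Q = "\<mu> \<Otimes>\<^sub>M \<nu>"
  have [measurable]: "fst \<in> borel_measurable ?Q" "snd \<in> borel_measurable ?Q" by measurable
  have d: "distr ?Q borel fst = \<mu>" "distr ?Q borel snd = \<nu>"
  proof -
    have "distr ?Q borel fst = distr ?Q \<mu> fst" "distr ?Q borel snd = distr ?Q \<nu> snd"
      using s by (auto intro: distr_cong)
    then show "distr ?Q borel fst = \<mu>" "distr ?Q borel snd = \<nu>"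
      using \<nu>.distr_pair_fst \<mu>.distr_pair_snd[OF \<nu>.sigma_finite_measure_axioms] by auto
  qed
  have "W1 \<mu> \<nu> \<le> (\<integral>\<^sup>+z. ennreal (dist (fst z) (snd z)) \<partial>?Q)"
    using W1_le[OF prob_space_axioms, of fst snd] by (simp add: d)
  also have "\<dots> \<le> (\<integral>\<^sup>+z. ennreal (norm (fst z)) + ennreal (norm (snd z)) \<partial>?Q)"
    by (intro nn_integral_mono) (simp flip: ennreal_plus add: ennreal_leI dist_norm norm_triangle_ineq4)
  also have "\<dots> = (\<integral>\<^sup>+z. ennreal (norm (fst z)) \<partial>?Q) + (\<integral>\<^sup>+z. ennreal (norm (snd z)) \<partial>?Q)"
    by (rule nn_integral_add) auto
  also have "(\<integral>\<^sup>+z. ennreal (norm (fst z)) \<partial>?Q) = (\<integral>\<^sup>+x. ennreal (norm x) \<partial>distr ?Q borel fst)"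
    by (simp add: nn_integral_distr)
  also have "(\<integral>\<^sup>+z. ennreal (norm (snd z)) \<partial>?Q) = (\<integral>\<^sup>+x. ennreal (norm x) \<partial>distr ?Q borel snd)"
    by (simp add: nn_integral_distr)
  also have "(\<integral>\<^sup>+x. ennreal (norm x) \<partial>distr ?Q borel fst) + (\<integral>\<^sup>+x. ennreal (norm x) \<partial>distr ?Q borel snd) < \<infinity>"
    unfolding d using assms by (simp add: P1_iff)
  finally show ?thesis .
qed

text \<open>Vanishing \<open>W1\<close> gives couplings of arbitrarily small cost, but not at once
  one of cost zero. By Markov's inequality such a coupling moves little mass farther than \<delta>,
  so the mass that \<mu> puts on \<open>C\<close> is found by \<nu> in the \<delta>-neighbourhood of
  \<open>C\<close>, up to a small error; closedness of \<open>C\<close> then lets \<delta> tend to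
  zero.\<close>

lemma W1_zero_closed_le:
  fixes \<mu> \<nu> :: "'a::euclidean_space measure"
  assumes "W1 \<mu> \<nu> = 0" and C: "closed C" and \<nu>: "\<nu> \<in> prob_measures"
  shows "emeasure \<mu> C \<le> emeasure \<nu> C"
proof (cases "C = {}")
  case ne: False
  have sets_\<nu>: "sets \<nu> = sets borel" and "prob_space \<nu>" using \<nu> by (auto simp: prob_measures_def)
  interpret \<nu>: prob_space \<nu> by fact
  have C'[measurable]: "{y. infdist y C \<le> \<delta>} \<in> sets borel" for \<delta>
    by (intro borel_closed closed_Collect_le continuous_intros)
  have C''[measurable]: "C \<in> sets borel" using C by simp
  have fat: "emeasure \<mu> C \<le> emeasure \<nu> {y. infdist y C \<le> \<delta>}" if \<delta>: "\<delta> > 0" for \<delta>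
  proof (rule ennreal_le_epsilon)
    fix e :: real assume e: "0 < e"
    \<comment> \<open>The budget is \<open>e * \<delta>\<close> because Markov's inequality at level
      \<delta> divides it by \<delta>.\<close>
    have "W1 \<mu> \<nu> < ennreal (e * \<delta>)" using e \<delta> assms(1) by simp
    then obtain \<pi> where \<pi>: "\<pi> \<in> couplings \<mu> \<nu>" and cost: "(\<integral>\<^sup>+z. ennreal (dist (fst z) (snd z)) \<partial>\<pi>) < ennreal (e * \<delta>)"
      by (rule W1_less_obtains_coupling)
    from \<pi> have sets_\<pi>: "sets \<pi> = sets borel" and d: "distr \<pi> borel fst = \<mu>" "distr \<pi> borel snd = \<nu>"
      and fs: "fst \<in> borel_measurable \<pi>" "snd \<in> borel_measurable \<pi>"
      by (auto elim: couplingsE)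
    note fs[measurable]
    have [measurable]: "(\<lambda>z. dist (fst z) (snd z)) \<in> borel_measurable \<pi>"
      by (rule borel_measurable_dist[OF fs])
    have [measurable]: "(\<lambda>z. infdist (snd z) C) \<in> borel_measurable \<pi>"
      by (rule measurable_compose[OF fs(2) borel_measurable_continuous_onI]) (intro continuous_intros)
    have sp: "space \<pi> = UNIV" using sets_eq_imp_space_eq[OF sets_\<pi>] by simp
    have "emeasure \<mu> C = emeasure \<pi> {z \<in> space \<pi>. fst z \<in> C}"
      unfolding d(1)[symmetric] by (subst emeasure_distr) (auto simp: vimage_def sp)
    also have "\<dots> \<le> emeasure \<pi> ({z \<in> space \<pi>. infdist (snd z) C \<le> \<delta>} \<union> {z \<in> space \<pi>. 1 \<le> ennreal (1 / \<delta>) * ennreal (dist (fst z) (snd z))})"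
    proof (rule emeasure_mono)
      have "\<delta> \<le> dist (fst z) (snd z)" if "fst z \<in> C" "\<not> infdist (snd z) C \<le> \<delta>" for z
        using infdist_le[OF that(1), of "snd z"] that(2) by (simp add: dist_commute)
      then show "{z \<in> space \<pi>. fst z \<in> C} \<subseteq> {z \<in> space \<pi>. infdist (snd z) C \<le> \<delta>} \<union> {z \<in> space \<pi>. 1 \<le> ennreal (1 / \<delta>) * ennreal (dist (fst z) (snd z))}"
        using \<delta> by (auto simp flip: ennreal_mult simp: divide_simps)
    qed measurable
    also have "\<dots> \<le> emeasure \<pi> {z \<in> space \<pi>. infdist (snd z) C \<le> \<delta>} + emeasure \<pi> {z \<in> space \<pi>. 1 \<le> ennreal (1 / \<delta>) * ennreal (dist (fst z) (snd z))}"
      by (rule emeasure_subadditive) measurable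
    also have "\<dots> \<le> emeasure \<pi> {z \<in> space \<pi>. infdist (snd z) C \<le> \<delta>} + ennreal (1 / \<delta>) * (\<integral>\<^sup>+z. ennreal (dist (fst z) (snd z)) \<partial>\<pi>)"
    proof (rule add_left_mono)
      have "emeasure \<pi> {z \<in> space \<pi>. 1 \<le> ennreal (1 / \<delta>) * ennreal (dist (fst z) (snd z))} \<le>
          ennreal (1 / \<delta>) * (\<integral>\<^sup>+z. ennreal (dist (fst z) (snd z)) * indicator (space \<pi>) z \<partial>\<pi>)"
        by (rule nn_integral_Markov_inequality) measurable
      then show "emeasure \<pi> {z \<in> space \<pi>. 1 \<le> ennreal (1 / \<delta>) * ennreal (dist (fst z) (snd z))} \<le>
          ennreal (1 / \<delta>) * (\<integral>\<^sup>+z. ennreal (dist (fst z) (snd z)) \<partial>\<pi>)"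
        by (simp add: sp)
    qed
    also have "\<dots> \<le> emeasure \<pi> {z \<in> space \<pi>. infdist (snd z) C \<le> \<delta>} + ennreal (1 / \<delta>) * ennreal (e * \<delta>)"
      using cost by (intro add_left_mono mult_left_mono) auto
    also have "ennreal (1 / \<delta>) * ennreal (e * \<delta>) = ennreal e"
      using e \<delta> by (simp flip: ennreal_mult)
    also have "emeasure \<pi> {z \<in> space \<pi>. infdist (snd z) C \<le> \<delta>} = emeasure \<nu> {y. infdist y C \<le> \<delta>}"
      unfolding d(2)[symmetric] by (subst emeasure_distr) (auto simp: vimage_def sp)
    finally show "emeasure \<mu> C \<le> emeasure \<nu> {y. infdist y C \<le> \<delta>} + ennreal e" .
  qed
  let ?A = "\<lambda>n. {y. infdist y C \<le> inverse (real (Suc n))}"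
  have "(\<Inter>n. ?A n) = C"
  proof (intro equalityI subsetI)
    fix y assume y: "y \<in> (\<Inter>n. ?A n)"
    have "infdist y C \<le> 0"
      using y by (intro LIMSEQ_le_const[OF LIMSEQ_inverse_real_of_nat]) auto
    then have "infdist y C = 0" using infdist_nonneg[of y C] by simp
    then show "y \<in> C" using in_closed_iff_infdist_zero[OF C ne] by simp
  qed auto
  moreover have "(\<lambda>n. emeasure \<nu> (?A n)) \<longlonglongrightarrow> emeasure \<nu> (\<Inter>n. ?A n)"
  proof (rule Lim_emeasure_decseq)
    show "range ?A \<subseteq> sets \<nu>" unfolding sets_\<nu> by auto
    show "decseq ?A"
    proof (rule decseq_SucI)
      show "?A (Suc n) \<subseteq> ?A n" for n
      proof -
        have "inverse (real (Suc (Suc n))) \<le> inverse (real (Suc n))" by (rule le_imp_inverse_le) auto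
        then show ?thesis by (meson Collect_mono order_trans)
      qed
    qed
  qed simp
  ultimately have "(\<lambda>n. emeasure \<nu> (?A n)) \<longlonglongrightarrow> emeasure \<nu> C" by simp
  then show ?thesis
    by (rule LIMSEQ_le_const) (auto intro!: fat)
qed simp

text \<open>Closed sets form an intersection-stable generator of the Borel sets, and symmetry of
  \<open>W1\<close> makes the one-sided comparison an equality on them.\<close>

lemma W1_zero_imp_eq:
  assumes 0: "W1 \<mu> \<nu> = 0" and "\<mu> \<in> prob_measures" "\<nu> \<in> prob_measures"
  shows "\<mu> = \<nu>"
proof (rule measure_eqI_generator_eq)
  show "Int_stable {C :: 'a set. closed C}" by (auto simp: Int_stable_def)
  show "emeasure \<mu> C = emeasure \<nu> C" if "C \<in> {C. closed C}" for C
    using that assms W1_zero_closed_le[OF 0, of C] W1_zero_closed_le[of \<nu> \<mu> C]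
    by (simp add: W1_commute[of \<nu> \<mu>] order.antisym)
  show "sets \<mu> = sigma_sets UNIV {C. closed C}" "sets \<nu> = sigma_sets UNIV {C. closed C}"
    using assms(2,3) unfolding prob_measures_def by (auto simp: borel_eq_closed)
  show "emeasure \<mu> UNIV \<noteq> \<infinity>" for i :: nat
    using assms(2) prob_space.emeasure_le_1[of \<mu> UNIV]
    by (auto simp: prob_measures_def top_unique)
qed auto

section \<open>Completeness and the fixed point theorem\<close>

lemma summable_dist_convergent:
  fixes x :: "nat \<Rightarrow> 'a::banach"
  assumes fin: "(\<Sum>k. ennreal (dist (x k) (x (Suc k)))) \<noteq> top"
  shows "convergent x"
    and "ennreal (dist (x n) (lim x)) \<le> (\<Sum>k. ennreal (dist (x (n + k)) (x (Suc (n + k)))))"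
proof -
  have sd: "summable (\<lambda>k. dist (x k) (x (Suc k)))"
    by (rule summable_suminf_not_top[OF _ fin]) simp
  then have "summable (\<lambda>k. norm (x (Suc k) - x k))" by (simp add: dist_norm norm_minus_commute)
  then have "summable (\<lambda>k. x (Suc k) - x k)" by (rule summable_norm_cancel)
  then have "convergent (\<lambda>m. \<Sum>k<m. x (Suc k) - x k)" by (simp add: summable_iff_convergent)
  then have "convergent (\<lambda>m. x 0 + (x m - x 0))"
    unfolding sum_lessThan_telescope by (intro convergent_add convergent_const)
  then show conv: "convergent x" by simp
  have sdn: "summable (\<lambda>k. dist (x (n + k)) (x (Suc (n + k))))"
    using summable_ignore_initial_segment[OF sd, of n] by (simp add: add.commute)
  have tri: "dist (x n) (x (n + m)) \<le> (\<Sum>k<m. dist (x (n + k)) (x (Suc (n + k))))" for m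
  proof (induction m)
    case (Suc m)
    then show ?case using dist_triangle[of "x n" "x (n + Suc m)" "x (n + m)"] by simp
  qed simp
  have "dist (x n) (lim x) \<le> (\<Sum>k. dist (x (n + k)) (x (Suc (n + k))))"
  proof (rule LIMSEQ_le_const2)
    have "(\<lambda>m. x (m + n)) \<longlonglongrightarrow> lim x"
      using conv by (simp add: convergent_LIMSEQ_iff LIMSEQ_ignore_initial_segment)
    then show "(\<lambda>m. dist (x n) (x (m + n))) \<longlonglongrightarrow> dist (x n) (lim x)"
      by (intro tendsto_intros)
    show "\<exists>N. \<forall>m\<ge>N. dist (x n) (x (m + n)) \<le> (\<Sum>k. dist (x (n + k)) (x (Suc (n + k))))"
    proof (intro exI allI impI)
      fix m
      have "dist (x n) (x (n + m)) \<le> (\<Sum>k. dist (x (n + k)) (x (Suc (n + k))))"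
        by (rule order.trans[OF tri sum_le_suminf[OF sdn]]) auto
      then show "dist (x n) (x (m + n)) \<le> (\<Sum>k. dist (x (n + k)) (x (Suc (n + k))))"
        by (simp add: add.commute)
    qed
  qed
  \<comment> \<open>The bound is kept in \<open>ennreal\<close> because \<open>W1_complete\<close>
    integrates it over the sample space.\<close>
  then show "ennreal (dist (x n) (lim x)) \<le> (\<Sum>k. ennreal (dist (x (n + k)) (x (Suc (n + k)))))"
    by (subst suminf_ennreal2[OF _ sdn]) (auto intro: ennreal_leI)
qed

text \<open>All \<open>\<mu> n\<close> become laws of variables \<open>X n\<close> on one space
  whose consecutive distances have summable expectations. Almost surely these distances are then
  summable themselves, so \<open>X n\<close> converges, and the law of its limit is the limit in
  \<open>W1\<close>.\<close>

lemma W1_complete: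
  fixes \<mu> :: "nat \<Rightarrow> 'a::euclidean_space measure" and w :: "nat \<Rightarrow> real"
  assumes \<mu>: "\<And>n. \<mu> n \<in> P1" and W: "\<And>n. W1 (\<mu> n) (\<mu> (Suc n)) \<le> ennreal (w n)"
    and w: "summable w" and w0: "\<And>n. 0 \<le> w n"
  obtains \<mu>' where "\<mu>' \<in> P1" "(\<lambda>n. W1 (\<mu> n) \<mu>') \<longlonglongrightarrow> 0"
proof -
  define \<delta> :: "nat \<Rightarrow> real" where "\<delta> n = (1 / 2) ^ n" for n
  have \<delta>: "\<delta> n > 0" for n by (simp add: \<delta>_def)
  have "\<exists>\<pi>. \<pi> \<in> couplings (\<mu> n) (\<mu> (Suc n)) \<and> (\<integral>\<^sup>+z. ennreal (dist (fst z) (snd z)) \<partial>\<pi>) < ennreal (w n) + ennreal (\<delta> n)" for n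
  proof -
    have "W1 (\<mu> n) (\<mu> (Suc n)) < ennreal (w n) + ennreal (\<delta> n)"
      by (rule le_less_trans[OF W ennreal_less_add_pos[OF _ \<delta>]]) simp
    then show ?thesis by (rule W1_less_obtains_coupling) blast
  qed
  then obtain \<pi> where \<pi>: "\<And>n. \<pi> n \<in> couplings (\<mu> n) (\<mu> (Suc n))"
    and cost\<pi>: "\<And>n. (\<integral>\<^sup>+z. ennreal (dist (fst z) (snd z)) \<partial>\<pi> n) < ennreal (w n) + ennreal (\<delta> n)"
    using choice[of "\<lambda>n \<pi>. \<pi> \<in> couplings (\<mu> n) (\<mu> (Suc n)) \<and> (\<integral>\<^sup>+z. ennreal (dist (fst z) (snd z)) \<partial>\<pi>) < ennreal (w n) + ennreal (\<delta> n)"]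
    by blast
  obtain Q :: "(nat \<Rightarrow> 'a \<times> 'a) measure" and X Y where Q: "prob_space Q"
    and XY_meas[measurable]: "\<And>n. X n \<in> borel_measurable Q" "\<And>n. Y n \<in> borel_measurable Q"
    and XY: "\<And>n. distr Q borel (\<lambda>\<omega>. (X n \<omega>, Y n \<omega>)) = \<pi> n"
    and close: "\<And>n. AE \<omega> in Q. dist (Y n \<omega>) (X (Suc n) \<omega>) \<le> \<delta> n"
    by (rule glue_couplings[of \<pi> \<mu> \<delta>, OF \<pi> \<delta>]) (rule that)
  interpret prob_space Q by fact
  have X: "distr Q borel (X n) = \<mu> n" for n
  proof -
    have "distr Q borel (X n) = distr (\<pi> n) borel fst"
      unfolding XY[symmetric] by (simp add: distr_distr comp_def)
    then show ?thesis using \<pi>[of n] by (auto simp: couplings_def)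
  qed
  \<comment> \<open>One \<open>\<delta> n\<close> pays for the excess of the coupling over
    \<open>w n\<close>, the other for the gap between \<open>Y n\<close> and
    \<open>X (Suc n)\<close>.\<close>
  define a where "a n = w n + 2 * \<delta> n" for n
  have a0: "0 \<le> a n" for n using w0[of n] \<delta>[of n] by (simp add: a_def)
  have a: "summable a" unfolding a_def \<delta>_def using w by (intro summable_add summable_mult summable_geometric) auto
  have step: "(\<integral>\<^sup>+\<omega>. ennreal (dist (X n \<omega>) (X (Suc n) \<omega>)) \<partial>Q) \<le> ennreal (a n)" for n
  proof -
    have "(\<integral>\<^sup>+\<omega>. ennreal (dist (X n \<omega>) (X (Suc n) \<omega>)) \<partial>Q) \<le> (\<integral>\<^sup>+\<omega>. ennreal (dist (X n \<omega>) (Y n \<omega>)) + ennreal (\<delta> n) \<partial>Q)"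
    proof (rule nn_integral_mono_AE)
      show "AE \<omega> in Q. ennreal (dist (X n \<omega>) (X (Suc n) \<omega>)) \<le> ennreal (dist (X n \<omega>) (Y n \<omega>)) + ennreal (\<delta> n)"
        using close[of n]
      proof eventually_elim
        case (elim \<omega>)
        then have "dist (X n \<omega>) (X (Suc n) \<omega>) \<le> dist (X n \<omega>) (Y n \<omega>) + \<delta> n"
          using dist_triangle[of "X n \<omega>" "X (Suc n) \<omega>" "Y n \<omega>"] by simp
        then show ?case using \<delta>[of n] by (simp flip: ennreal_plus add: ennreal_leI)
      qed
    qed
    also have "\<dots> = (\<integral>\<^sup>+\<omega>. ennreal (dist (X n \<omega>) (Y n \<omega>)) \<partial>Q) + ennreal (\<delta> n)"
      by (simp add: nn_integral_add emeasure_space_1)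
    also have "(\<integral>\<^sup>+\<omega>. ennreal (dist (X n \<omega>) (Y n \<omega>)) \<partial>Q) = (\<integral>\<^sup>+z. ennreal (dist (fst z) (snd z)) \<partial>\<pi> n)"
      unfolding XY[symmetric] by (subst nn_integral_distr) simp_all
    also have "\<dots> + ennreal (\<delta> n) \<le> ennreal (w n) + ennreal (\<delta> n) + ennreal (\<delta> n)"
      using cost\<pi>[of n] by (intro add_right_mono) auto
    also have "\<dots> = ennreal (a n)"
      using w0[of n] \<delta>[of n] by (simp add: a_def flip: ennreal_plus)
    finally show ?thesis .
  qed
  have tail: "(\<integral>\<^sup>+\<omega>. (\<Sum>k. ennreal (dist (X (n + k) \<omega>) (X (Suc (n + k)) \<omega>))) \<partial>Q) \<le> ennreal (\<Sum>k. a (n + k))" for n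
  proof -
    have "(\<integral>\<^sup>+\<omega>. (\<Sum>k. ennreal (dist (X (n + k) \<omega>) (X (Suc (n + k)) \<omega>))) \<partial>Q) =
        (\<Sum>k. \<integral>\<^sup>+\<omega>. ennreal (dist (X (n + k) \<omega>) (X (Suc (n + k)) \<omega>)) \<partial>Q)"
      by (rule nn_integral_suminf) measurable
    also have "\<dots> \<le> (\<Sum>k. ennreal (a (n + k)))"
      by (intro suminf_le step) auto
    also have "\<dots> = ennreal (\<Sum>k. a (n + k))"
      using summable_ignore_initial_segment[OF a, of n] by (intro suminf_ennreal2 a0) (simp add: add.commute)
    finally show ?thesis .
  qed
  define X' where "X' \<omega> = lim (\<lambda>n. X n \<omega>)" for \<omega>
  have X'_meas[measurable]: "X' \<in> borel_measurable Q" unfolding X'_def by measurable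
  \<comment> \<open>The expected length of the path is finite, hence the length is finite almost
    surely; the value of \<open>lim\<close> on the remaining null set does not affect the
    integrals.\<close>
  have "AE \<omega> in Q. (\<Sum>k. ennreal (dist (X (0 + k) \<omega>) (X (Suc (0 + k)) \<omega>))) \<noteq> \<infinity>"
    by (rule nn_integral_PInf_AE) (use tail[of 0] in \<open>auto simp: top_unique\<close>)
  then have close': "AE \<omega> in Q. ennreal (dist (X n \<omega>) (X' \<omega>)) \<le> (\<Sum>k. ennreal (dist (X (n + k) \<omega>) (X (Suc (n + k)) \<omega>)))" for n
  proof eventually_elim
    case (elim \<omega>)
    then show ?case unfolding X'_def by (intro summable_dist_convergent(2)[of "\<lambda>n. X n \<omega>"]) simp
  qed
  have lim: "(\<integral>\<^sup>+\<omega>. ennreal (dist (X n \<omega>) (X' \<omega>)) \<partial>Q) \<le> ennreal (\<Sum>k. a (n + k))" for n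
    by (rule order.trans[OF nn_integral_mono_AE[OF close'] tail])
  define \<mu>' where "\<mu>' = distr Q borel X'"
  show ?thesis
  proof
    show "\<mu>' \<in> P1" unfolding P1_iff
    proof
      show "\<mu>' \<in> prob_measures" by (simp add: prob_measures_def \<mu>'_def prob_space_distr)
      have "(\<integral>\<^sup>+x. ennreal (norm x) \<partial>\<mu>') = (\<integral>\<^sup>+\<omega>. ennreal (norm (X' \<omega>)) \<partial>Q)"
        by (simp add: \<mu>'_def nn_integral_distr)
      also have "\<dots> \<le> (\<integral>\<^sup>+\<omega>. ennreal (norm (X 0 \<omega>)) + ennreal (dist (X 0 \<omega>) (X' \<omega>)) \<partial>Q)"
      proof (rule nn_integral_mono)
        fix \<omega>
        have "norm (X' \<omega>) \<le> norm (X 0 \<omega>) + dist (X 0 \<omega>) (X' \<omega>)"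
          using norm_triangle_ineq2[of "X' \<omega>" "X 0 \<omega>"] by (simp add: dist_norm norm_minus_commute)
        then show "ennreal (norm (X' \<omega>)) \<le> ennreal (norm (X 0 \<omega>)) + ennreal (dist (X 0 \<omega>) (X' \<omega>))"
          by (simp flip: ennreal_plus add: ennreal_leI)
      qed
      also have "\<dots> = (\<integral>\<^sup>+\<omega>. ennreal (norm (X 0 \<omega>)) \<partial>Q) + (\<integral>\<^sup>+\<omega>. ennreal (dist (X 0 \<omega>) (X' \<omega>)) \<partial>Q)"
        by (rule nn_integral_add) auto
      also have "(\<integral>\<^sup>+\<omega>. ennreal (norm (X 0 \<omega>)) \<partial>Q) = (\<integral>\<^sup>+x. ennreal (norm x) \<partial>\<mu> 0)"
        unfolding X[symmetric] by (simp add: nn_integral_distr)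
      also have "(\<integral>\<^sup>+x. ennreal (norm x) \<partial>\<mu> 0) + (\<integral>\<^sup>+\<omega>. ennreal (dist (X 0 \<omega>) (X' \<omega>)) \<partial>Q) < \<infinity>"
        using \<mu>[of 0] le_less_trans[OF lim[of 0], of \<infinity>] by (simp add: P1_iff)
      finally show "(\<integral>\<^sup>+x. ennreal (norm x) \<partial>\<mu>') < \<infinity>" .
    qed
    have le: "W1 (\<mu> n) \<mu>' \<le> ennreal (\<Sum>k. a (n + k))" for n
      using W1_le[OF Q XY_meas(1) X'_meas, of n] unfolding X \<mu>'_def
      by (rule order.trans[OF _ lim[unfolded \<mu>'_def]])
    have "(\<lambda>n. \<Sum>k. a (n + k)) \<longlonglongrightarrow> 0"
    proof (rule LIMSEQ_I)
      fix r :: real assume "0 < r"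
      from suminf_exist_split[OF this a] show "\<exists>N. \<forall>n\<ge>N. norm ((\<Sum>k. a (n + k)) - 0) < r"
        by (simp add: add.commute)
    qed
    then have "(\<lambda>n. ennreal (\<Sum>k. a (n + k))) \<longlonglongrightarrow> ennreal 0" by (rule tendsto_ennrealI)
    then show "(\<lambda>n. W1 (\<mu> n) \<mu>') \<longlonglongrightarrow> 0"
      using tendsto_sandwich[where f="\<lambda>_. 0::ennreal" and g="\<lambda>n. W1 (\<mu> n) \<mu>'" and h="\<lambda>n. ennreal (\<Sum>k. a (n + k))" and net=sequentially and c=0]
      by (simp add: le)
  qed
qed

text \<open>Banach iteration from \<open>\<mu>\<^sub>0\<close>. The first distance is finite on
  \<open>P1\<close>, so consecutive distances decay geometrically and \<open>W1_complete\<close>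
  provides a limit; \<open>W1_zero_imp_eq\<close> turns vanishing distances into equality of
  measures.\<close>

lemma W1_contraction_fixed_point:
  fixes \<Gamma> :: "'a::euclidean_space measure \<Rightarrow> 'a measure" and \<mu>\<^sub>0 :: "'a measure"
  assumes \<Gamma>: "\<And>\<mu>. \<mu> \<in> P1 \<Longrightarrow> \<Gamma> \<mu> \<in> P1" and \<kappa>: "0 \<le> \<kappa>" "\<kappa> < 1"
    and contr: "\<And>\<mu> \<nu>. \<mu> \<in> P1 \<Longrightarrow> \<nu> \<in> P1 \<Longrightarrow> W1 (\<Gamma> \<mu>) (\<Gamma> \<nu>) \<le> ennreal \<kappa> * W1 \<mu> \<nu>"
    and \<mu>0: "\<mu>\<^sub>0 \<in> P1"
  shows "\<exists>!\<mu>. \<mu> \<in> P1 \<and> \<Gamma> \<mu> = \<mu>"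
proof -
  define \<mu> where "\<mu> n = (\<Gamma> ^^ n) \<mu>\<^sub>0" for n
  have \<mu>: "\<mu> n \<in> P1" for n by (induction n) (auto simp: \<mu>_def \<mu>0 \<Gamma>)
  obtain d where d: "W1 (\<mu> 0) (\<mu> 1) = ennreal d" "0 \<le> d"
    using W1_finite[OF \<mu> \<mu>, of 0 1] by (cases "W1 (\<mu> 0) (\<mu> 1)" rule: ennreal_cases) auto
  have step: "W1 (\<mu> n) (\<mu> (Suc n)) \<le> ennreal (\<kappa> ^ n * d)" for n
  proof (induction n)
    case 0
    then show ?case using d by simp
  next
    case (Suc n)
    have "W1 (\<mu> (Suc n)) (\<mu> (Suc (Suc n))) = W1 (\<Gamma> (\<mu> n)) (\<Gamma> (\<mu> (Suc n)))" by (simp add: \<mu>_def)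
    also have "\<dots> \<le> ennreal \<kappa> * W1 (\<mu> n) (\<mu> (Suc n))" by (rule contr[OF \<mu> \<mu>])
    also have "\<dots> \<le> ennreal \<kappa> * ennreal (\<kappa> ^ n * d)" by (intro mult_left_mono Suc) simp
    also have "\<dots> = ennreal (\<kappa> ^ Suc n * d)" using \<kappa> d by (simp flip: ennreal_mult add: mult.assoc)
    finally show ?case .
  qed
  have "summable (\<lambda>n. \<kappa> ^ n * d)" using \<kappa> by (intro summable_mult2 summable_geometric) simp
  moreover have "0 \<le> \<kappa> ^ n * d" for n using \<kappa> d by simp
  ultimately obtain \<nu> where \<nu>: "\<nu> \<in> P1" and lim: "(\<lambda>n. W1 (\<mu> n) \<nu>) \<longlonglongrightarrow> 0"
    by (rule W1_complete[of \<mu> "\<lambda>n. \<kappa> ^ n * d", OF \<mu> step])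
  have "W1 (\<Gamma> \<nu>) \<nu> \<le> 0"
  proof (rule LIMSEQ_le_const)
    have "(\<lambda>n. W1 (\<mu> (Suc n)) \<nu>) \<longlonglongrightarrow> 0" by (rule LIMSEQ_Suc[OF lim])
    then have "(\<lambda>n. W1 (\<mu> n) \<nu> + W1 (\<mu> (Suc n)) \<nu>) \<longlonglongrightarrow> 0 + 0" by (intro tendsto_add lim)
    then show "(\<lambda>n. W1 (\<mu> n) \<nu> + W1 (\<mu> (Suc n)) \<nu>) \<longlonglongrightarrow> 0" by simp
    show "\<exists>N. \<forall>n\<ge>N. W1 (\<Gamma> \<nu>) \<nu> \<le> W1 (\<mu> n) \<nu> + W1 (\<mu> (Suc n)) \<nu>"
    proof (intro exI allI impI)
      fix n
      have "W1 (\<Gamma> \<nu>) \<nu> \<le> W1 (\<Gamma> \<nu>) (\<Gamma> (\<mu> n)) + W1 (\<mu> (Suc n)) \<nu>"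
        using W1_triangle[OF P1_prob_measures[OF \<nu>], of "\<Gamma> \<nu>" "\<Gamma> (\<mu> n)"] by (simp add: \<mu>_def)
      also have "W1 (\<Gamma> \<nu>) (\<Gamma> (\<mu> n)) \<le> ennreal \<kappa> * W1 \<nu> (\<mu> n)" by (rule contr[OF \<nu> \<mu>])
      also have "\<dots> \<le> 1 * W1 \<nu> (\<mu> n)" using \<kappa> by (intro mult_right_mono) auto
      finally show "W1 (\<Gamma> \<nu>) \<nu> \<le> W1 (\<mu> n) \<nu> + W1 (\<mu> (Suc n)) \<nu>"
        by (simp add: W1_commute[of \<nu>] add_mono)
    qed
  qed
  then have fp: "\<Gamma> \<nu> = \<nu>"
    by (intro W1_zero_imp_eq P1_prob_measures \<Gamma> \<nu>) simp
  show ?thesis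
  proof (rule ex1I[of _ \<nu>])
    fix \<rho> assume \<rho>: "\<rho> \<in> P1 \<and> \<Gamma> \<rho> = \<rho>"
    \<comment> \<open>For positive \<kappa> the inequality \<open>r \<le> \<kappa> * r\<close> does
      not exclude an infinite \<open>r\<close>, hence the passage to real numbers.\<close>
    obtain r where r: "W1 \<rho> \<nu> = ennreal r" "0 \<le> r"
      using W1_finite[of \<rho> \<nu>] \<rho> \<nu> by (cases "W1 \<rho> \<nu>" rule: ennreal_cases) auto
    have "ennreal r \<le> ennreal (\<kappa> * r)"
      using contr[of \<rho> \<nu>] \<rho> \<nu> fp \<kappa> r by (simp flip: ennreal_mult)
    then have "r * (1 - \<kappa>) \<le> 0" using \<kappa> r by (simp add: algebra_simps)
    then have "r = 0" using \<kappa> r by (simp add: mult_le_0_iff)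
    then show "\<rho> = \<nu>" using r \<rho> \<nu> by (intro W1_zero_imp_eq P1_prob_measures) auto
  qed (simp add: \<nu> fp)
qed

section \<open>Time shifts of stochastic integrals\<close>

lemma at_right_shift: "at_right (s + t) = filtermap ((+) s) (at_right t)" for s t :: real
proof -
  have "(\<lambda>x. x - - s) = (+) s" by (simp add: fun_eq_iff)
  then show ?thesis using filtermap_at_right_shift[of "- s" t] by (simp add: add.commute)
qed

lemma at_left_shift: "at_left (s + t) = filtermap ((+) s) (at_left t)" for s t :: real
proof -
  have "- (s + t) = - t - s" by simp
  then have "at_left (s + t) = filtermap uminus (filtermap (\<lambda>x. x - s) (at_right (- t)))"
    unfolding at_left_minus[of "s + t"] filtermap_at_right_shift by (simp only:)
  also have "\<dots> = filtermap ((+) s) (filtermap uminus (at_right (- t)))"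
    by (simp add: filtermap_filtermap)
  finally show ?thesis by (simp add: at_left_minus[of t])
qed

lemma tendsto_at_right_shift:
  fixes x :: "real \<Rightarrow> 'a::topological_space"
  shows "((\<lambda>t. x (s + t)) \<longlongrightarrow> l) (at_right t) \<longleftrightarrow> (x \<longlongrightarrow> l) (at_right (s + t))"
  by (simp add: at_right_shift filterlim_filtermap)

lemma tendsto_at_left_shift:
  fixes x :: "real \<Rightarrow> 'a::topological_space"
  shows "((\<lambda>t. x (s + t)) \<longlongrightarrow> l) (at_left t) \<longleftrightarrow> (x \<longlongrightarrow> l) (at_left (s + t))"
  by (simp add: at_left_shift filterlim_filtermap)

text \<open>\<open>Lim\<close> is a definite description, and the shift replaces its predicate by an
  equivalent one; the equation therefore holds even where no left limit exists.\<close>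

lemma left_limit_shift: "left_limit (\<lambda>t. X (s + t)) t = left_limit X (s + t)"
  by (simp add: left_limit_def fun_eq_iff Topological_Spaces.Lim_def tendsto_at_left_shift[of "\<lambda>t. X t \<omega>" for \<omega>])

section \<open>Operations that preserve cadlag paths\<close>

lemma cadlag_shift: "cadlag x \<Longrightarrow> 0 \<le> s \<Longrightarrow> cadlag (\<lambda>t. x (s + t))"
  unfolding cadlag_def tendsto_at_right_shift tendsto_at_left_shift by auto

lemma cadlag_const: "cadlag (\<lambda>_. c)"
  unfolding cadlag_def by auto

lemma cadlagI:
  assumes "\<And>t. 0 \<le> t \<Longrightarrow> (x \<longlongrightarrow> x t) (at_right t)" "\<And>t. 0 < t \<Longrightarrow> \<exists>l. (x \<longlongrightarrow> l) (at_left t)"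
  shows "cadlag x"
  using assms by (simp add: cadlag_def)

lemma cadlag_at_right: "cadlag x \<Longrightarrow> 0 \<le> t \<Longrightarrow> (x \<longlongrightarrow> x t) (at_right t)"
  by (simp add: cadlag_def)

lemma cadlag_at_left:
  assumes "cadlag x" "0 < t" obtains l where "(x \<longlongrightarrow> l) (at_left t)"
  using assms by (auto simp: cadlag_def)

lemma cadlag_diff:
  fixes x y :: "real \<Rightarrow> 'a::real_normed_vector"
  assumes x: "cadlag x" and y: "cadlag y"
  shows "cadlag (\<lambda>t. x t - y t)"
proof (rule cadlagI)
  fix t :: real assume t: "0 < t"
  obtain l where l: "(x \<longlongrightarrow> l) (at_left t)" using x t by (rule cadlag_at_left)
  obtain m where m: "(y \<longlongrightarrow> m) (at_left t)" using y t by (rule cadlag_at_left)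
  from tendsto_diff[OF l m] show "\<exists>l. ((\<lambda>t. x t - y t) \<longlongrightarrow> l) (at_left t)" ..
qed (intro tendsto_diff cadlag_at_right x y)

lemma cadlag_sum:
  fixes x :: "'i \<Rightarrow> real \<Rightarrow> 'a::real_normed_vector"
  assumes x: "\<And>i. i \<in> A \<Longrightarrow> cadlag (x i)"
  shows "cadlag (\<lambda>t. \<Sum>i\<in>A. x i t)"
proof (rule cadlagI)
  fix t :: real assume "0 < t"
  then have "\<forall>i\<in>A. \<exists>l. (x i \<longlongrightarrow> l) (at_left t)"
    using x by (simp add: cadlag_def)
  from bchoice[OF this] obtain l where "\<forall>i\<in>A. (x i \<longlongrightarrow> l i) (at_left t)" ..
  then have "((\<lambda>t. \<Sum>i\<in>A. x i t) \<longlongrightarrow> (\<Sum>i\<in>A. l i)) (at_left t)" by (intro tendsto_sum) simp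
  then show "\<exists>l. ((\<lambda>t. \<Sum>i\<in>A. x i t) \<longlongrightarrow> l) (at_left t)" ..
qed (intro tendsto_sum cadlag_at_right x)

lemma cadlag_bounded_linear:
  assumes f: "bounded_linear f" and x: "cadlag x"
  shows "cadlag (\<lambda>t. f (x t))"
proof (rule cadlagI)
  fix t :: real assume t: "0 < t"
  obtain l where l: "(x \<longlongrightarrow> l) (at_left t)" using x t by (rule cadlag_at_left)
  from bounded_linear.tendsto[OF f l] show "\<exists>l. ((\<lambda>t. f (x t)) \<longlongrightarrow> l) (at_left t)" ..
qed (intro bounded_linear.tendsto[OF f] cadlag_at_right x)

text \<open>Before \<open>v\<close> the stopped path is \<open>x\<close>, afterwards it is constant.
  At \<open>t = v\<close> it is already constant to the right but still follows \<open>x\<close> to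
  the left, which is why the two case distinctions differ.\<close>

lemma cadlag_stop:
  assumes x: "cadlag x" and v: "0 \<le> v"
  shows "cadlag (\<lambda>t. x (min t v))"
  unfolding cadlag_def
proof (intro conjI allI impI)
  fix t :: real assume t: "0 \<le> t"
  show "((\<lambda>t. x (min t v)) \<longlongrightarrow> x (min t v)) (at_right t)"
  proof (cases "t < v")
    case True
    have "eventually (\<lambda>r. x r = x (min r v)) (at_right t)"
      using True by (auto simp: eventually_at_right_field intro!: exI[of _ v])
    moreover have "(x \<longlongrightarrow> x (min t v)) (at_right t)"
      using x t True by (simp add: cadlag_def)
    ultimately show ?thesis by (rule Lim_transform_eventually[rotated])
  next
    case False
    have "eventually (\<lambda>r. x (min t v) = x (min r v)) (at_right t)"
      using False by (auto simp: eventually_at_right_field intro!: exI[of _ "t + 1"])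
    then show ?thesis by (rule Lim_transform_eventually[OF tendsto_const])
  qed
next
  fix t :: real assume t: "0 < t"
  show "\<exists>l. ((\<lambda>t. x (min t v)) \<longlongrightarrow> l) (at_left t)"
  proof (cases "t \<le> v")
    case True
    have "eventually (\<lambda>r. x r = x (min r v)) (at_left t)"
      using True by (auto simp: eventually_at_left_field intro!: exI[of _ 0] t)
    moreover obtain l where "(x \<longlongrightarrow> l) (at_left t)"
      using x t by (auto simp: cadlag_def)
    ultimately show ?thesis by (blast intro: Lim_transform_eventually)
  next
    case False
    have "eventually (\<lambda>r. x v = x (min r v)) (at_left t)"
      using False by (auto simp: eventually_at_left_field intro!: exI[of _ v])
    then show ?thesis by (blast intro: Lim_transform_eventually[OF tendsto_const])
  qed
qed

lemma borel_measurable_matrix_vector_mult [measurable (raw)]: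
  fixes f :: "'w \<Rightarrow> real^'n^'m" and g :: "'w \<Rightarrow> real^'n"
  assumes "f \<in> borel_measurable N" "g \<in> borel_measurable N"
  shows "(\<lambda>\<omega>. f \<omega> *v g \<omega>) \<in> borel_measurable N"
proof (rule borel_measurable_continuous_Pair[OF assms])
  show "continuous_on UNIV (\<lambda>p. (fst p :: real^'n^'m) *v snd p)"
    unfolding matrix_vector_mult_def by (intro continuous_intros)
qed

section \<open>Integrals on a filtered probability space\<close>

locale filtered_prob_space =
  fixes M :: "'w measure" and F :: "real \<Rightarrow> 'w measure"
  assumes filtered: "complete_filtered_prob_space M F"
begin

lemma space_F: "0 \<le> t \<Longrightarrow> space (F t) = space M"
  and sets_F: "0 \<le> t \<Longrightarrow> sets (F t) \<subseteq> sets M"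
  and F_mono: "0 \<le> s \<Longrightarrow> s \<le> t \<Longrightarrow> sets (F s) \<subseteq> sets (F t)"
  using filtered by (auto simp: complete_filtered_prob_space_def)

sublocale prob_space M
  using filtered by (simp add: complete_filtered_prob_space_def)

lemma measurable_F_mono:
  assumes "f \<in> F s \<rightarrow>\<^sub>M N" "0 \<le> s" "s \<le> t"
  shows "f \<in> F t \<rightarrow>\<^sub>M N"
  using assms(1) by (rule measurable_mono[OF order_refl refl, THEN subsetD, rotated -1])
    (use assms F_mono space_F in auto)

lemma measurable_F:
  assumes "f \<in> F t \<rightarrow>\<^sub>M N" "0 \<le> t"
  shows "f \<in> M \<rightarrow>\<^sub>M N"
  using assms(1) by (rule measurable_mono[OF order_refl refl, THEN subsetD, rotated -1])
    (use assms sets_F space_F in auto)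

lemma filtered_shift:
  assumes "0 \<le> s"
  shows "complete_filtered_prob_space M (\<lambda>t. F (s + t))"
proof -
  have "null_sets M \<subseteq> sets (F s)"
  proof (rule order.trans[OF _ F_mono[OF order_refl assms]])
    show "null_sets M \<subseteq> sets (F 0)" using filtered by (simp only: complete_filtered_prob_space_def)
  qed
  with filtered assms show ?thesis unfolding complete_filtered_prob_space_def by simp
qed

lemma cadlag_adapted_measurable:
  assumes "cadlag_adapted M F X" "0 \<le> t"
  shows "X t \<in> borel_measurable M"
  by (rule measurable_F[of _ t]) (use assms in \<open>simp_all add: cadlag_adapted_def adapted_def\<close>)

lemma cadlag_adapted_shift:
  assumes "cadlag_adapted M F X" "0 \<le> s"
  shows "cadlag_adapted M (\<lambda>t. F (s + t)) (\<lambda>t. X (s + t))"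
  using assms cadlag_shift[of "\<lambda>t. X t \<omega>" s for \<omega>]
  unfolding cadlag_adapted_def adapted_def by simp

lemma cadlag_adapted_increment:
  fixes X :: "real \<Rightarrow> 'w \<Rightarrow> 'a::{real_normed_vector, second_countable_topology}"
  assumes X: "cadlag_adapted M F X" and s: "0 \<le> s"
  shows "cadlag_adapted M (\<lambda>t. F (s + t)) (\<lambda>t \<omega>. X (s + t) \<omega> - X s \<omega>)"
proof -
  have "X s \<in> borel_measurable (F (s + t))" if "0 \<le> t" for t
    by (rule measurable_F_mono[of _ s]) (use X s that in \<open>auto simp: cadlag_adapted_def adapted_def\<close>)
  moreover have "cadlag (\<lambda>t. X (s + t) \<omega> - X s \<omega>)" if "\<omega> \<in> space M" for \<omega>
  proof (rule cadlag_diff[OF _ cadlag_const])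
    show "cadlag (\<lambda>t. X (s + t) \<omega>)"
      using X s that by (intro cadlag_shift[of "\<lambda>t. X t \<omega>"]) (auto simp: cadlag_adapted_def)
  qed
  ultimately show ?thesis
    using X s unfolding cadlag_adapted_def adapted_def by (auto intro!: borel_measurable_diff)
qed

lemma elementary_cadlag_adapted:
  fixes Z :: "real \<Rightarrow> 'w \<Rightarrow> real^'n" and \<xi> :: "nat \<Rightarrow> 'w \<Rightarrow> real^'n^'d"
  assumes Z: "cadlag_adapted M F Z"
    and e: "\<forall>i<k::nat. 0 \<le> u i \<and> u i \<le> v i \<and> \<xi> i \<in> borel_measurable (F (u i)) \<and> bounded (\<xi> i ` space M)"
  shows "cadlag_adapted M F (\<lambda>t \<omega>. \<Sum>i<k. \<xi> i \<omega> *v (Z (min t (v i)) \<omega> - Z (min t (u i)) \<omega>))"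
  unfolding cadlag_adapted_def adapted_def
proof (intro conjI allI impI ballI)
  fix t :: real assume t: "0 \<le> t"
  show "(\<lambda>\<omega>. \<Sum>i<k. \<xi> i \<omega> *v (Z (min t (v i)) \<omega> - Z (min t (u i)) \<omega>)) \<in> borel_measurable (F t)"
  proof (rule borel_measurable_sum)
    fix i assume "i \<in> {..<k}"
    then have i: "0 \<le> u i" "u i \<le> v i" "\<xi> i \<in> borel_measurable (F (u i))" using e by auto
    show "(\<lambda>\<omega>. \<xi> i \<omega> *v (Z (min t (v i)) \<omega> - Z (min t (u i)) \<omega>)) \<in> borel_measurable (F t)"
    \<comment> \<open>Before time \<open>u i\<close> the factor \<open>\<xi> i\<close> need not be
      measurable for \<open>F t\<close>, but there the increment of \<open>Z\<close> that it
      multiplies is zero.\<close>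
    proof (cases "t \<le> u i")
      case True
      then show ?thesis using i by (simp add: min_absorb1)
    next
      case False
      have "Z r \<in> borel_measurable (F t)" if "0 \<le> r" "r \<le> t" for r
        by (rule measurable_F_mono[of _ r]) (use Z that in \<open>auto simp: cadlag_adapted_def adapted_def\<close>)
      moreover have "\<xi> i \<in> borel_measurable (F t)"
        by (rule measurable_F_mono[of _ "u i"]) (use i False in auto)
      ultimately show ?thesis
        using i t by (intro borel_measurable_matrix_vector_mult borel_measurable_diff) auto
    qed
  qed
next
  fix \<omega> assume "\<omega> \<in> space M"
  then have Z\<omega>: "cadlag (\<lambda>t. Z t \<omega>)" using Z by (simp add: cadlag_adapted_def)
  show "cadlag (\<lambda>t. \<Sum>i<k. \<xi> i \<omega> *v (Z (min t (v i)) \<omega> - Z (min t (u i)) \<omega>))"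
  proof (rule cadlag_sum)
    fix i assume "i \<in> {..<k}"
    then have "0 \<le> u i" "0 \<le> v i" using e by force+
    then have "cadlag (\<lambda>t. Z (min t (v i)) \<omega> - Z (min t (u i)) \<omega>)"
      by (intro cadlag_diff cadlag_stop[OF Z\<omega>])
    then show "cadlag (\<lambda>t. \<xi> i \<omega> *v (Z (min t (v i)) \<omega> - Z (min t (u i)) \<omega>))"
      by (rule cadlag_bounded_linear[OF matrix_vector_mul_bounded_linear])
  qed
qed

lemma stoch_integral_cadlag_adapted:
  assumes "stoch_integral M F Z H I" and Z: "cadlag_adapted M F Z"
  shows "cadlag_adapted M F I"
  using assms(1)
  by (induction rule: stoch_integral.induct) (auto intro: elementary_cadlag_adapted[OF Z])

lemma finite_stopping_time_const: "finite_stopping_time M F (\<lambda>_. c)"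
  unfolding finite_stopping_time_def
proof (intro allI impI)
  fix t :: real assume "0 \<le> t"
  then show "{\<omega> \<in> space M. c \<le> t} \<in> sets (F t)"
    using sets.top[of "F t"] by (cases "c \<le> t") (simp_all add: space_F)
qed

lemma locally_uniformly_bounded_const:
  assumes "\<And>k t \<omega>. \<omega> \<in> space M \<Longrightarrow> norm (H k t \<omega>) \<le> C"
  shows "locally_uniformly_bounded M F H"
  unfolding locally_uniformly_bounded_def
proof (intro exI conjI allI)
  show "finite_stopping_time M F (\<lambda>_. real m)" for m by (rule finite_stopping_time_const)
  show "AE \<omega> in M. incseq (\<lambda>m. real m) \<and> filterlim (\<lambda>m. real m) at_top sequentially"
    by (auto simp: incseq_def filterlim_real_sequentially)
  show "AE \<omega> in M. \<forall>k t. 0 < t \<and> t \<le> real m \<longrightarrow> norm (H k t \<omega>) \<le> C" for m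
    using assms by (intro AE_I2) auto
qed

lemma elementary_bounded:
  fixes \<xi> :: "nat \<Rightarrow> 'w \<Rightarrow> 'a::real_normed_vector"
  assumes e: "\<forall>i<k::nat. bounded (\<xi> i ` space M)"
  obtains C where "\<And>\<omega> t. \<omega> \<in> space M \<Longrightarrow> norm (\<Sum>i<k. if u i < t \<and> t \<le> v i then \<xi> i \<omega> else 0 :: 'a) \<le> C"
proof -
  have "\<forall>i\<in>{..<k}. \<exists>c. 0 \<le> c \<and> (\<forall>\<omega>\<in>space M. norm (\<xi> i \<omega>) \<le> c)"
  proof
    fix i assume "i \<in> {..<k}"
    then obtain c where "0 < c" "\<forall>x\<in>\<xi> i ` space M. norm x \<le> c"
      using e unfolding bounded_pos by blast
    then show "\<exists>c. 0 \<le> c \<and> (\<forall>\<omega>\<in>space M. norm (\<xi> i \<omega>) \<le> c)" by (intro exI[of _ c]) auto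
  qed
  then obtain c where c: "\<forall>i\<in>{..<k}. 0 \<le> c i \<and> (\<forall>\<omega>\<in>space M. norm (\<xi> i \<omega>) \<le> c i)"
    using bchoice by metis
  show ?thesis
  proof (rule that)
    fix \<omega> t assume "\<omega> \<in> space M"
    then show "norm (\<Sum>i<k. if u i < t \<and> t \<le> v i then \<xi> i \<omega> else 0) \<le> (\<Sum>i<k. c i)"
      using c by (intro sum_norm_le) auto
  qed
qed

text \<open>The localizing times and the bounds of an approximating sequence survive its pointwise
  limit. The purpose is to make the constant sequence \<open>H\<close> admissible in
  \<open>dominated_limit\<close>.\<close>

lemma stoch_integral_locally_bounded:
  assumes "stoch_integral M F Z H I"
  shows "locally_uniformly_bounded M F (\<lambda>k::nat. H)"
  using assms
proof (induction rule: stoch_integral.induct)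
  case (elementary k u v \<xi>)
  then have "\<forall>i<k. bounded (\<xi> i ` space M)" by simp
  then obtain C where C: "\<And>\<omega> t. \<omega> \<in> space M \<Longrightarrow> norm (\<Sum>i<k. if u i < t \<and> t \<le> v i then \<xi> i \<omega> else 0) \<le> C"
    by (rule elementary_bounded[where u=u and v=v]) (rule that)
  then show ?case by (rule locally_uniformly_bounded_const)
next
  case (dominated_limit Hs Is H I)
  then obtain T C where T: "\<And>m. finite_stopping_time M F (T m)"
    "AE \<omega> in M. incseq (\<lambda>m. T m \<omega>) \<and> filterlim (\<lambda>m. T m \<omega>) at_top sequentially"
    and C: "\<And>m::nat. AE \<omega> in M. \<forall>k t. 0 < t \<and> t \<le> T m \<omega> \<longrightarrow> norm (Hs k t \<omega>) \<le> C m"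
    unfolding locally_uniformly_bounded_def by blast
  show ?case
    unfolding locally_uniformly_bounded_def
  proof (intro exI conjI allI)
    show "AE \<omega> in M. \<forall>k t. 0 < t \<and> t \<le> T m \<omega> \<longrightarrow> norm (H t \<omega>) \<le> C m" for m
      using C[of m] \<open>AE \<omega> in M. \<forall>t>0. (\<lambda>k. Hs k t \<omega>) \<longlonglongrightarrow> H t \<omega>\<close>
    proof eventually_elim
      case (elim \<omega>)
      show ?case
      proof (intro allI impI)
        fix t assume t: "0 < t \<and> t \<le> T m \<omega>"
        then have "(\<lambda>k. norm (Hs k t \<omega>)) \<longlonglongrightarrow> norm (H t \<omega>)" using elim by (intro tendsto_norm) auto
        then show "norm (H t \<omega>) \<le> C m" by (rule LIMSEQ_le_const2) (use elim t in auto)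
      qed
    qed
  qed (use T in auto)
qed

lemma tendsto_in_prob_const:
  assumes "\<And>\<omega>. \<omega> \<in> space M \<Longrightarrow> Y \<omega> = Y' \<omega>"
  shows "tendsto_in_prob M (\<lambda>k. Y) Y'"
proof -
  have "{\<omega> \<in> space M. dist (Y \<omega>) (Y' \<omega>) > \<epsilon>} = {}" if "\<epsilon> > 0" for \<epsilon>
    using that assms by auto
  then show ?thesis
    unfolding tendsto_in_prob_def by (intro allI impI) (simp only: measure_empty tendsto_const)
qed

lemma tendsto_in_prob_diff:
  fixes X Y :: "nat \<Rightarrow> 'w \<Rightarrow> 'a::{real_normed_vector, second_countable_topology}"
  assumes [measurable]: "\<And>k. X k \<in> borel_measurable M" "\<And>k. Y k \<in> borel_measurable M"
    "X' \<in> borel_measurable M" "Y' \<in> borel_measurable M"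
    and X: "tendsto_in_prob M X X'" and Y: "tendsto_in_prob M Y Y'"
  shows "tendsto_in_prob M (\<lambda>k \<omega>. X k \<omega> - Y k \<omega>) (\<lambda>\<omega>. X' \<omega> - Y' \<omega>)"
  unfolding tendsto_in_prob_def
proof (intro allI impI)
  fix \<epsilon> :: real assume "\<epsilon> > 0"
  then have \<epsilon>: "\<epsilon> / 2 > 0" by simp
  let ?A = "\<lambda>k. {\<omega> \<in> space M. dist (X k \<omega>) (X' \<omega>) > \<epsilon> / 2}"
  let ?B = "\<lambda>k. {\<omega> \<in> space M. dist (Y k \<omega>) (Y' \<omega>) > \<epsilon> / 2}"
  let ?C = "\<lambda>k. {\<omega> \<in> space M. dist (X k \<omega> - Y k \<omega>) (X' \<omega> - Y' \<omega>) > \<epsilon>}"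
  have lim: "(\<lambda>k. measure M (?A k) + measure M (?B k)) \<longlonglongrightarrow> 0 + 0"
    using X[unfolded tendsto_in_prob_def, rule_format, OF \<epsilon>] Y[unfolded tendsto_in_prob_def, rule_format, OF \<epsilon>]
    by (rule tendsto_add)
  have le: "measure M (?C k) \<le> measure M (?A k) + measure M (?B k)" for k
  proof -
    have "?C k \<subseteq> ?A k \<union> ?B k"
    proof
      fix \<omega> assume \<omega>: "\<omega> \<in> ?C k"
      have "dist (X k \<omega> - Y k \<omega>) (X' \<omega> - Y' \<omega>) \<le> dist (X k \<omega>) (X' \<omega>) + dist (Y k \<omega>) (Y' \<omega>)"
        using dist_triangle_add[of "X k \<omega>" "- Y k \<omega>" "X' \<omega>" "- Y' \<omega>"] by (simp add: dist_minus)
      with \<omega> show "\<omega> \<in> ?A k \<union> ?B k" by simp linarith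
    qed
    then have "measure M (?C k) \<le> measure M (?A k \<union> ?B k)"
      by (intro finite_measure_mono) measurable
    also have "\<dots> \<le> measure M (?A k) + measure M (?B k)"
      by (rule measure_Un_le) measurable
    finally show ?thesis .
  qed
  show "(\<lambda>k. measure M (?C k)) \<longlonglongrightarrow> 0"
  proof (rule tendsto_sandwich[OF _ _ tendsto_const])
    show "(\<lambda>k. measure M (?A k) + measure M (?B k)) \<longlonglongrightarrow> 0" using lim by (simp only: add_0_left)
    show "\<forall>\<^sub>F k in sequentially. measure M (?C k) \<le> measure M (?A k) + measure M (?B k)"
      using le by (rule always_eventually[OF allI])
  qed (simp only: measure_nonneg eventually_True)
qed

text \<open>Closing a constant sequence under dominated limits changes the integrand at times \<open>t \<le> 0\<close> and the
  integral at times \<open>t < 0\<close>, which the definition of the integral leaves arbitrary.\<close>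

lemma stoch_integral_cong:
  assumes int: "stoch_integral M F Z H I"
    and "AE \<omega> in M. \<forall>t>0. H t \<omega> = H' t \<omega>"
    and "cadlag_adapted M F I'"
    and "\<And>t \<omega>. 0 \<le> t \<Longrightarrow> \<omega> \<in> space M \<Longrightarrow> I t \<omega> = I' t \<omega>"
  shows "stoch_integral M F Z H' I'"
proof (rule stoch_integral.dominated_limit)
  show "\<forall>k::nat. stoch_integral M F Z H I" using int by simp
  show "locally_uniformly_bounded M F (\<lambda>k. H)" by (rule stoch_integral_locally_bounded[OF int])
  show "AE \<omega> in M. \<forall>t>0. (\<lambda>k. H t \<omega>) \<longlonglongrightarrow> H' t \<omega>" using assms(2) by eventually_elim auto
  show "\<forall>t\<ge>0. tendsto_in_prob M (\<lambda>k. I t) (I' t)" using assms(4) by (auto intro: tendsto_in_prob_const)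
qed fact

end

section \<open>Restarting the integral and the noise at a later time\<close>

context filtered_prob_space
begin

lemma AE_shift_time:
  fixes P :: "real \<Rightarrow> 'w \<Rightarrow> bool"
  assumes "AE \<omega> in M. \<forall>t>0. P t \<omega>" "0 \<le> s"
  shows "AE \<omega> in M. \<forall>t>0. P (s + t) \<omega>"
  using assms(1)
proof eventually_elim
  case (elim \<omega>)
  have "0 < s + t" if "0 < t" for t using assms(2) that by simp
  with elim show ?case by blast
qed

lemma locally_uniformly_bounded_shift:
  assumes H: "locally_uniformly_bounded M F H" and s: "0 \<le> s"
  shows "locally_uniformly_bounded M (\<lambda>t. F (s + t)) (\<lambda>k t. H k (s + t))"
proof -
  obtain T C where T: "\<And>m. finite_stopping_time M F (T m)"
    and lim: "AE \<omega> in M. incseq (\<lambda>m. T m \<omega>) \<and> filterlim (\<lambda>m. T m \<omega>) at_top sequentially"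
    and C: "\<And>m::nat. AE \<omega> in M. \<forall>k t. 0 < t \<and> t \<le> T m \<omega> \<longrightarrow> norm (H k t \<omega>) \<le> C m"
    using H unfolding locally_uniformly_bounded_def by blast
  show ?thesis
    unfolding locally_uniformly_bounded_def
  proof (intro exI conjI allI)
    \<comment> \<open>\<open>T m - s\<close> may be negative, which the definition allows: its
      sublevel set at \<open>t\<close> is that of \<open>T m\<close> at \<open>s + t\<close>, and
      where it is negative the bound is imposed at no time at all.\<close>
    show "finite_stopping_time M (\<lambda>t. F (s + t)) (\<lambda>\<omega>. T m \<omega> - s)" for m
      unfolding finite_stopping_time_def
    proof (intro allI impI)
      fix t :: real assume t: "0 \<le> t"
      have "{\<omega> \<in> space M. T m \<omega> - s \<le> t} = {\<omega> \<in> space M. T m \<omega> \<le> s + t}" by auto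
      then show "{\<omega> \<in> space M. T m \<omega> - s \<le> t} \<in> sets (F (s + t))"
        using T[of m] s t by (simp add: finite_stopping_time_def)
    qed
    show "AE \<omega> in M. incseq (\<lambda>m. T m \<omega> - s) \<and> filterlim (\<lambda>m. T m \<omega> - s) at_top sequentially"
      using lim
    proof eventually_elim
      case (elim \<omega>)
      have "filterlim (\<lambda>m. - s + T m \<omega>) at_top sequentially"
        by (rule filterlim_tendsto_add_at_top[OF tendsto_const]) (use elim in simp)
      with elim show ?case by (simp add: incseq_def)
    qed
    show "AE \<omega> in M. \<forall>k t. 0 < t \<and> t \<le> T m \<omega> - s \<longrightarrow> norm (H k (s + t) \<omega>) \<le> C m" for m
      using C[of m] by eventually_elim (use s in auto)
  qed
qed

text \<open>The integral is an inductive closure, so the identity is checked for elementary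
  integrands and inherited by dominated limits: if the approximations converge in probability at
  \<open>s + t\<close> and at \<open>s\<close>, so do their increments.\<close>

lemma stoch_integral_shift:
  assumes int: "stoch_integral M F Z H I" and Z: "cadlag_adapted M F Z" and s: "0 \<le> s"
  shows "stoch_integral M (\<lambda>t. F (s + t)) (\<lambda>t \<omega>. Z (s + t) \<omega> - Z s \<omega>)
           (\<lambda>t. H (s + t)) (\<lambda>t \<omega>. I (s + t) \<omega> - I s \<omega>)"
  using int
proof (induction rule: stoch_integral.induct)
  case (elementary k u v \<xi>)
  interpret shifted: filtered_prob_space M "\<lambda>t. F (s + t)"
    by unfold_locales (rule filtered_shift[OF s])
  \<comment> \<open>An interval that begins before \<open>s\<close> is cut at the new origin. Since
    \<open>s + u' i\<close> is \<open>max s (u i)\<close>, the factor \<open>\<xi> i\<close> stays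
    measurable at the left end.\<close>
  define u' where "u' i = max 0 (u i - s)" for i
  define v' where "v' i = max 0 (v i - s)" for i
  have e: "\<forall>i<k. 0 \<le> u' i \<and> u' i \<le> v' i \<and> \<xi> i \<in> borel_measurable (F (s + u' i)) \<and> bounded (\<xi> i ` space M)"
  proof (intro allI impI)
    fix i assume "i < k"
    with elementary have i: "0 \<le> u i" "u i \<le> v i" "\<xi> i \<in> borel_measurable (F (u i))" "bounded (\<xi> i ` space M)"
      by auto
    have "\<xi> i \<in> borel_measurable (F (s + u' i))"
      by (rule measurable_F_mono[OF i(3) i(1)]) (simp add: u'_def)
    with i show "0 \<le> u' i \<and> u' i \<le> v' i \<and> \<xi> i \<in> borel_measurable (F (s + u' i)) \<and> bounded (\<xi> i ` space M)"
      by (simp add: u'_def v'_def)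
  qed
  have "stoch_integral M (\<lambda>t. F (s + t)) (\<lambda>t \<omega>. Z (s + t) \<omega> - Z s \<omega>)
       (\<lambda>t \<omega>. \<Sum>i<k. if u' i < t \<and> t \<le> v' i then \<xi> i \<omega> else 0)
       (\<lambda>t \<omega>. \<Sum>i<k. \<xi> i \<omega> *v ((Z (s + min t (v' i)) \<omega> - Z s \<omega>) - (Z (s + min t (u' i)) \<omega> - Z s \<omega>)))"
    using e by (rule stoch_integral.elementary)
  then show ?case
  \<comment> \<open>For \<open>t \<le> 0\<close> the clipped integrand is zero whereas the shifted
    one may not be, so the two are identified only at positive times.\<close>
  proof (rule shifted.stoch_integral_cong)
    show "AE \<omega> in M. \<forall>t>0. (\<Sum>i<k. if u' i < t \<and> t \<le> v' i then \<xi> i \<omega> else 0) =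
        (\<Sum>i<k. if u i < s + t \<and> s + t \<le> v i then \<xi> i \<omega> else 0)"
      by (intro AE_I2 allI impI sum.cong) (auto simp: u'_def v'_def)
    show "cadlag_adapted M (\<lambda>t. F (s + t))
       (\<lambda>t \<omega>. (\<Sum>i<k. \<xi> i \<omega> *v (Z (min (s + t) (v i)) \<omega> - Z (min (s + t) (u i)) \<omega>)) -
          (\<Sum>i<k. \<xi> i \<omega> *v (Z (min s (v i)) \<omega> - Z (min s (u i)) \<omega>)))"
      by (rule cadlag_adapted_increment[OF elementary_cadlag_adapted[OF Z elementary] s])
    fix t :: real and \<omega> assume t: "0 \<le> t"
    \<comment> \<open>If \<open>r \<le> s\<close>, both sides vanish; otherwise clipping does
      nothing and both sides are the increment of \<open>Z\<close> from \<open>s\<close> to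
      \<open>min (s + t) r\<close>.\<close>
    have "Z (s + min t (max 0 (r - s))) \<omega> - Z s \<omega> = Z (min (s + t) r) \<omega> - Z (min s r) \<omega>" for r
      using t by (cases "r \<le> s"; cases "s + t \<le> r") (auto simp: min_def max_def)
    then show "(\<Sum>i<k. \<xi> i \<omega> *v ((Z (s + min t (v' i)) \<omega> - Z s \<omega>) - (Z (s + min t (u' i)) \<omega> - Z s \<omega>))) =
        (\<Sum>i<k. \<xi> i \<omega> *v (Z (min (s + t) (v i)) \<omega> - Z (min (s + t) (u i)) \<omega>)) -
        (\<Sum>i<k. \<xi> i \<omega> *v (Z (min s (v i)) \<omega> - Z (min s (u i)) \<omega>))"
      unfolding sum_subtractf[symmetric] matrix_vector_mult_diff_distrib[symmetric] u'_def v'_def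
      by (intro sum.cong refl arg_cong2[where f="(*v)"]) simp
  qed
next
  case (dominated_limit Hs Is H I)
  have Is: "stoch_integral M F Z (Hs k) (Is k)" for k using dominated_limit by simp
  have Im: "Is k t \<in> borel_measurable M" "I t \<in> borel_measurable M" if "0 \<le> t" for k t
    using that cadlag_adapted_measurable stoch_integral_cadlag_adapted[OF Is Z]
      \<open>cadlag_adapted M F I\<close> by blast+
  show ?case
  proof (rule stoch_integral.dominated_limit)
    show "\<forall>k. stoch_integral M (\<lambda>t. F (s + t)) (\<lambda>t \<omega>. Z (s + t) \<omega> - Z s \<omega>)
        (\<lambda>t. Hs k (s + t)) (\<lambda>t \<omega>. Is k (s + t) \<omega> - Is k s \<omega>)"
      using dominated_limit by simp
    show "locally_uniformly_bounded M (\<lambda>t. F (s + t)) (\<lambda>k t. Hs k (s + t))"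
      using \<open>locally_uniformly_bounded M F Hs\<close> s by (rule locally_uniformly_bounded_shift)
    show "AE \<omega> in M. \<forall>t>0. (\<lambda>k. Hs k (s + t) \<omega>) \<longlonglongrightarrow> H (s + t) \<omega>"
      using \<open>AE \<omega> in M. \<forall>t>0. (\<lambda>k. Hs k t \<omega>) \<longlonglongrightarrow> H t \<omega>\<close> s by (rule AE_shift_time)
    show "cadlag_adapted M (\<lambda>t. F (s + t)) (\<lambda>t \<omega>. I (s + t) \<omega> - I s \<omega>)"
      using \<open>cadlag_adapted M F I\<close> s by (rule cadlag_adapted_increment)
    show "\<forall>t\<ge>0. tendsto_in_prob M (\<lambda>k \<omega>. Is k (s + t) \<omega> - Is k s \<omega>) (\<lambda>\<omega>. I (s + t) \<omega> - I s \<omega>)"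
      using \<open>\<forall>t\<ge>0. tendsto_in_prob M (\<lambda>k. Is k t) (I t)\<close> s
      by (intro allI impI tendsto_in_prob_diff Im) auto
  qed
qed

text \<open>Increments of the shifted noise are increments of \<open>Z\<close>, so independence and
  stationarity carry over. The second claim yields the marginals that \<open>weak_solution\<close>
  prescribes.\<close>

lemma levy_process_shift:
  fixes Z :: "real \<Rightarrow> 'w \<Rightarrow> 'a::euclidean_space"
  assumes Z: "levy_process M F Z" and s: "0 \<le> s"
  shows "levy_process M (\<lambda>t. F (s + t)) (\<lambda>t \<omega>. Z (s + t) \<omega> - Z s \<omega>)"
    and "0 \<le> t \<Longrightarrow> law M (\<lambda>\<omega>. Z (s + t) \<omega> - Z s \<omega>) = law M (Z t)"
proof -
  have inc: "law M (\<lambda>\<omega>. Z t \<omega> - Z r \<omega>) = law M (Z (t - r))" if "0 \<le> r" "r \<le> t" for r t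
    using Z that by (simp add: levy_process_def)
  have indep: "indep_set (sets (F r)) {(\<lambda>\<omega>. Z t \<omega> - Z r \<omega>) -` A \<inter> space M | A. A \<in> sets borel}"
    if "0 \<le> r" "r \<le> t" for r t
    using Z that by (simp add: levy_process_def)
  show "levy_process M (\<lambda>t. F (s + t)) (\<lambda>t \<omega>. Z (s + t) \<omega> - Z s \<omega>)"
    unfolding levy_process_def
  proof (intro conjI allI impI)
    show "cadlag_adapted M (\<lambda>t. F (s + t)) (\<lambda>t \<omega>. Z (s + t) \<omega> - Z s \<omega>)"
      using Z s by (intro cadlag_adapted_increment) (simp_all add: levy_process_def)
    fix r t :: real assume rt: "0 \<le> r \<and> r \<le> t"
    have eq: "(\<lambda>\<omega>. Z (s + t) \<omega> - Z s \<omega> - (Z (s + r) \<omega> - Z s \<omega>)) = (\<lambda>\<omega>. Z (s + t) \<omega> - Z (s + r) \<omega>)"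
      by (simp add: fun_eq_iff)
    show "indep_set (sets (F (s + r)))
        {(\<lambda>\<omega>. Z (s + t) \<omega> - Z s \<omega> - (Z (s + r) \<omega> - Z s \<omega>)) -` A \<inter> space M | A. A \<in> sets borel}"
      unfolding eq by (rule indep) (use s rt in auto)
    show "law M (\<lambda>\<omega>. Z (s + t) \<omega> - Z s \<omega> - (Z (s + r) \<omega> - Z s \<omega>)) = law M (\<lambda>\<omega>. Z (s + (t - r)) \<omega> - Z s \<omega>)"
      unfolding eq using inc[of "s + r" "s + t"] inc[of s "s + (t - r)"] s rt by simp
  qed simp
  show "law M (\<lambda>\<omega>. Z (s + t) \<omega> - Z s \<omega>) = law M (Z t)" if "0 \<le> t"
    using inc[of s "s + t"] s that by simp
qed

end

section \<open>The flow of laws\<close>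

lemma set_integral_shift:
  fixes f :: "real \<Rightarrow> 'a::euclidean_space"
  assumes f: "set_integrable lborel {0..s + t} f" and s: "0 \<le> s" and t: "0 \<le> t"
  shows "set_integrable lborel {0..t} (\<lambda>r. f (s + r))"
    and "(LINT r:{0..s + t}|lborel. f r) = (LINT r:{0..s}|lborel. f r) + (LINT r:{0..t}|lborel. f (s + r))"
proof -
  have 1: "set_integrable lborel {0..s} f" and 2: "set_integrable lborel {s..s + t} f"
    using s t by (auto intro!: set_integrable_subset[OF f])
  have ind: "(\<lambda>r. indicator {s..s + t} (s + 1 * r) *\<^sub>R f (s + 1 * r)) = (\<lambda>r. indicator {0..t} r *\<^sub>R f (s + r))"
    by (auto simp: fun_eq_iff indicator_def)
  show "set_integrable lborel {0..t} (\<lambda>r. f (s + r))"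
    using 2 unfolding set_integrable_def ind[symmetric] by (subst lborel_integrable_real_affine_iff) auto
  have "{0..s + t} = {0..s} \<union> {s..s + t}" using s t by auto
  then have "(LINT r:{0..s + t}|lborel. f r) = (LINT r:{0..s} \<union> {s..s + t}|lborel. f r)" by simp
  also have "\<dots> = (LINT r:{0..s}|lborel. f r) + (LINT r:{s..s + t}|lborel. f r)"
  proof (rule set_integral_Un_AE[OF _ _ _ 1 2])
    show "AE x in lborel. \<not> (x \<in> {0..s} \<and> x \<in> {s..s + t})"
      using AE_lborel_singleton[of s] by eventually_elim auto
  qed auto
  also have "(LINT r:{s..s + t}|lborel. f r) = (LINT r:{0..t}|lborel. f (s + r))"
    unfolding set_lebesgue_integral_def ind[symmetric] by (subst lborel_integral_real_affine[of 1 _ s]) auto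
  finally show "(LINT r:{0..s + t}|lborel. f r) = (LINT r:{0..s}|lborel. f r) + (LINT r:{0..t}|lborel. f (s + r))" .
qed

text \<open>Time-homogeneity enters here: the coefficients depend on time only through the law of
  the solution, and that law is shifted together with the process. The new noise consists of the
  increments of \<open>Z\<close> after \<open>s\<close>.\<close>

lemma weak_solution_shift:
  assumes sol: "weak_solution b \<sigma> M\<^sub>0 Z\<^sub>0 \<eta> M F Z X" and s: "0 \<le> s"
  shows "weak_solution b \<sigma> M\<^sub>0 Z\<^sub>0 (law M (X s)) M (\<lambda>t. F (s + t)) (\<lambda>t \<omega>. Z (s + t) \<omega> - Z s \<omega>) (\<lambda>t. X (s + t))"
proof -
  interpret filtered_prob_space M F
    using sol by unfold_locales (simp add: weak_solution_def)
  have Z: "levy_process M F Z" and X: "cadlag_adapted M F X" and law_Z: "\<And>t. 0 \<le> t \<Longrightarrow> law M (Z t) = law M\<^sub>0 (Z\<^sub>0 t)"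
    using sol by (auto simp: weak_solution_def solves_sde_def)
  then have Zc: "cadlag_adapted M F Z" by (simp add: levy_process_def)
  obtain I where I: "stoch_integral M F Z (\<lambda>t \<omega>. \<sigma> (left_limit X t \<omega>) (law M (X t))) I"
    and eq: "AE \<omega> in M. \<forall>t\<ge>0.
           set_integrable lborel {0..t} (\<lambda>s. b (X s \<omega>) (law M (X s))) \<and>
           X t \<omega> = X 0 \<omega> + (LINT s:{0..t}|lborel. b (X s \<omega>) (law M (X s))) + I t \<omega>"
    using sol by (auto simp: weak_solution_def solves_sde_def)
  have "stoch_integral M (\<lambda>t. F (s + t)) (\<lambda>t \<omega>. Z (s + t) \<omega> - Z s \<omega>)
      (\<lambda>t \<omega>. \<sigma> (left_limit (\<lambda>t. X (s + t)) t \<omega>) (law M (X (s + t)))) (\<lambda>t \<omega>. I (s + t) \<omega> - I s \<omega>)"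
    using stoch_integral_shift[OF I Zc s] by (simp add: left_limit_shift)
  moreover have "AE \<omega> in M. \<forall>t\<ge>0.
      set_integrable lborel {0..t} (\<lambda>r. b (X (s + r) \<omega>) (law M (X (s + r)))) \<and>
      X (s + t) \<omega> = X (s + 0) \<omega> + (LINT r:{0..t}|lborel. b (X (s + r) \<omega>) (law M (X (s + r)))) + (I (s + t) \<omega> - I s \<omega>)"
    using eq
  proof eventually_elim
    case (elim \<omega>)
    show ?case
    proof (intro allI impI)
      fix t :: real assume t: "0 \<le> t"
      let ?f = "\<lambda>r. b (X r \<omega>) (law M (X r))"
      have "0 \<le> s + t" using s t by simp
      \<comment> \<open>The restarted equation is the equation at \<open>s + t\<close> minus the
        equation at \<open>s\<close>.\<close>
      note at_st = elim[rule_format, OF this] and at_s = elim[rule_format, OF s]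
      have f: "set_integrable lborel {0..s + t} ?f" using at_st ..
      from set_integral_shift[OF f s t] show "set_integrable lborel {0..t} (\<lambda>r. ?f (s + r)) \<and>
          X (s + t) \<omega> = X (s + 0) \<omega> + (LINT r:{0..t}|lborel. ?f (s + r)) + (I (s + t) \<omega> - I s \<omega>)"
        by (simp add: at_st[THEN conjunct2] at_s[THEN conjunct2])
    qed
  qed
  ultimately have "solves_sde b \<sigma> M (\<lambda>t. F (s + t)) (\<lambda>t \<omega>. Z (s + t) \<omega> - Z s \<omega>) (\<lambda>t. X (s + t))"
    using cadlag_adapted_shift[OF X s] unfolding solves_sde_def by (intro conjI exI)
  then show ?thesis
    using filtered_shift[OF s] levy_process_shift[OF Z s] law_Z by (simp add: weak_solution_def)
qed

text \<open>Coefficients see only the marginal laws of the given solution, so agreement along this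
  flow of laws suffices. It is known for \<open>t \<ge> 0\<close> only, and
  \<open>stoch_integral_cong\<close> carries the integral over to the new integrand.\<close>

lemma weak_solution_cong:
  assumes sol: "weak_solution b \<sigma> M\<^sub>0 Z\<^sub>0 \<eta> M F Z X"
    and eq: "\<And>t x. 0 \<le> t \<Longrightarrow> b x (law M (X t)) = b' x (law M (X t))"
      "\<And>t x. 0 \<le> t \<Longrightarrow> \<sigma> x (law M (X t)) = \<sigma>' x (law M (X t))"
  shows "weak_solution b' \<sigma>' M\<^sub>0 Z\<^sub>0 \<eta> M F Z X"
proof -
  interpret filtered_prob_space M F
    using sol by unfold_locales (simp add: weak_solution_def)
  have Z: "cadlag_adapted M F Z" and X: "cadlag_adapted M F X"
    using sol by (auto simp: weak_solution_def solves_sde_def levy_process_def)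
  obtain I where I: "stoch_integral M F Z (\<lambda>t \<omega>. \<sigma> (left_limit X t \<omega>) (law M (X t))) I"
    and drift: "AE \<omega> in M. \<forall>t\<ge>0.
           set_integrable lborel {0..t} (\<lambda>s. b (X s \<omega>) (law M (X s))) \<and>
           X t \<omega> = X 0 \<omega> + (LINT s:{0..t}|lborel. b (X s \<omega>) (law M (X s))) + I t \<omega>"
    using sol by (auto simp: weak_solution_def solves_sde_def)
  have "stoch_integral M F Z (\<lambda>t \<omega>. \<sigma>' (left_limit X t \<omega>) (law M (X t))) I"
    by (rule stoch_integral_cong[OF I _ stoch_integral_cadlag_adapted[OF I Z]]) (auto simp: eq)
  moreover have "set_integrable lborel {0..t} (\<lambda>s. b (X s \<omega>) (law M (X s))) =
      set_integrable lborel {0..t} (\<lambda>s. b' (X s \<omega>) (law M (X s)))"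
    "(LINT s:{0..t}|lborel. b (X s \<omega>) (law M (X s))) = (LINT s:{0..t}|lborel. b' (X s \<omega>) (law M (X s)))" for t \<omega>
  proof -
    have "(\<lambda>s. indicator {0..t} s *\<^sub>R b (X s \<omega>) (law M (X s))) =
        (\<lambda>s. indicator {0..t} s *\<^sub>R b' (X s \<omega>) (law M (X s)))"
      by (auto simp: fun_eq_iff indicator_def eq)
    then show "set_integrable lborel {0..t} (\<lambda>s. b (X s \<omega>) (law M (X s))) =
        set_integrable lborel {0..t} (\<lambda>s. b' (X s \<omega>) (law M (X s)))"
      "(LINT s:{0..t}|lborel. b (X s \<omega>) (law M (X s))) = (LINT s:{0..t}|lborel. b' (X s \<omega>) (law M (X s)))"
      unfolding set_integrable_def set_lebesgue_integral_def by simp_all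
  qed
  ultimately have "solves_sde b' \<sigma>' M F Z X"
    using X drift unfolding solves_sde_def by (intro conjI exI) simp_all
  then show ?thesis using sol by (simp add: weak_solution_def)
qed

section \<open>Laws at fixed times\<close>

lemma law_of_process_law:
  assumes "\<And>t. 0 \<le> t \<Longrightarrow> X t \<in> borel_measurable M" "0 \<le> t"
  shows "law M (X t) = distr (process_law M X) borel (\<lambda>x. x t)"
proof -
  have "(\<lambda>x. x t) \<in> (\<Pi>\<^sub>M t\<in>{0..}. borel) \<rightarrow>\<^sub>M borel"
    using assms(2) by (intro measurable_component_singleton) simp
  moreover have "(\<lambda>\<omega>. \<lambda>t\<in>{0..}. X t \<omega>) \<in> M \<rightarrow>\<^sub>M (\<Pi>\<^sub>M t\<in>{0..}. borel)"
    using assms(1) by (intro measurable_restrict) simp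
  ultimately show ?thesis
    using assms(2) by (simp add: process_law_def distr_distr comp_def)
qed

text \<open>Uniqueness in law justifies the definite description in \<open>law_at\<close>: two
  solutions share their law on path space and hence the marginal at \<open>t\<close>. Afterwards
  \<open>law_at\<close> can be computed from any convenient solution, such as a restarted one or one
  borrowed from another equation.\<close>

lemma law_at_eq:
  assumes wp: "well_posed b \<sigma> M\<^sub>0 Z\<^sub>0" and \<eta>: "\<eta> \<in> P1"
    and sol: "weak_solution b \<sigma> M\<^sub>0 Z\<^sub>0 \<eta> M F Z X" and t: "0 \<le> t"
  shows "law_at b \<sigma> M\<^sub>0 Z\<^sub>0 t \<eta> = law M (X t)"
  unfolding law_at_def
proof (rule the_equality)
  show "\<exists>M' F' Z' X'. weak_solution b \<sigma> M\<^sub>0 Z\<^sub>0 \<eta> M' F' Z' X' \<and> law M (X t) = law M' (X' t)"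
    using sol by blast
next
  have meas: "Y r \<in> borel_measurable N" if "weak_solution b \<sigma> M\<^sub>0 Z\<^sub>0 \<eta> N G W Y" "0 \<le> r" for N G W Y r
  proof -
    interpret filtered_prob_space N G
      using that by unfold_locales (simp add: weak_solution_def)
    show ?thesis
      using that by (intro cadlag_adapted_measurable) (auto simp: weak_solution_def solves_sde_def)
  qed
  fix \<rho> assume "\<exists>M F Z X. weak_solution b \<sigma> M\<^sub>0 Z\<^sub>0 \<eta> M F Z X \<and> \<rho> = law M (X t)"
  then obtain N G W Y where Y: "weak_solution b \<sigma> M\<^sub>0 Z\<^sub>0 \<eta> N G W Y" and \<rho>: "\<rho> = law N (Y t)" by blast
  have "process_law N Y = process_law M X"
    using wp[unfolded well_posed_def, rule_format, OF \<eta>, THEN conjunct2, THEN conjunct1] Y sol by blast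
  then show "\<rho> = law M (X t)"
    unfolding \<rho> using law_of_process_law[of Y N, OF meas[OF Y] t] law_of_process_law[of X M, OF meas[OF sol] t]
    by (simp only:)
qed

lemma well_posed_obtains_solution:
  assumes wp: "well_posed b \<sigma> M\<^sub>0 Z\<^sub>0" and \<eta>: "\<eta> \<in> P1"
  obtains M F Z X where "weak_solution b \<sigma> M\<^sub>0 Z\<^sub>0 \<eta> M F Z X"
    "\<And>t. 0 \<le> t \<Longrightarrow> law_at b \<sigma> M\<^sub>0 Z\<^sub>0 t \<eta> = law M (X t)" "\<And>t. 0 \<le> t \<Longrightarrow> law M (X t) \<in> P1"
proof -
  note wp\<eta> = wp[unfolded well_posed_def, rule_format, OF \<eta>]
  from wp\<eta>[THEN conjunct1] obtain M F Z X where sol: "weak_solution b \<sigma> M\<^sub>0 Z\<^sub>0 \<eta> M F Z X"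
    by (elim exE)
  show ?thesis
  proof (rule that[OF sol])
    show "law_at b \<sigma> M\<^sub>0 Z\<^sub>0 t \<eta> = law M (X t)" if "0 \<le> t" for t
      using wp \<eta> sol that by (rule law_at_eq)
    show "law M (X t) \<in> P1" if "0 \<le> t" for t
      using wp\<eta>[THEN conjunct2, THEN conjunct2] sol that by blast
  qed
qed

lemma law_at_P1:
  assumes "well_posed b \<sigma> M\<^sub>0 Z\<^sub>0" "\<eta> \<in> P1" "0 \<le> t"
  shows "law_at b \<sigma> M\<^sub>0 Z\<^sub>0 t \<eta> \<in> P1"
  using assms(1,2) by (rule well_posed_obtains_solution) (use assms(3) in simp)

text \<open>Both sides are read off from one solution: the left directly, the right from its restart
  at \<open>s\<close>, whose initial law again lies in \<open>P1\<close>.\<close>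

lemma law_at_semigroup:
  assumes wp: "well_posed b \<sigma> M\<^sub>0 Z\<^sub>0" and \<eta>: "\<eta> \<in> P1" and s: "0 \<le> s" and t: "0 \<le> t"
  shows "law_at b \<sigma> M\<^sub>0 Z\<^sub>0 (s + t) \<eta> = law_at b \<sigma> M\<^sub>0 Z\<^sub>0 t (law_at b \<sigma> M\<^sub>0 Z\<^sub>0 s \<eta>)"
proof -
  obtain M F Z X where sol: "weak_solution b \<sigma> M\<^sub>0 Z\<^sub>0 \<eta> M F Z X"
    and law: "\<And>t. 0 \<le> t \<Longrightarrow> law_at b \<sigma> M\<^sub>0 Z\<^sub>0 t \<eta> = law M (X t)"
    and P1: "\<And>t. 0 \<le> t \<Longrightarrow> law M (X t) \<in> P1"
    using wp \<eta> by (rule well_posed_obtains_solution) (rule that)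
  show ?thesis
    using law_at_eq[OF wp P1[OF s] weak_solution_shift[OF sol s] t] s t by (simp add: law)
qed

text \<open>Each direction takes existence from the equation whose invariance is assumed, where the
  solution has constant marginal laws, and uniqueness from the other equation, which identifies its
  flow with these laws.\<close>

lemma invariant_iff_frozen:
  assumes wp: "well_posed b \<sigma> M\<^sub>0 Z\<^sub>0" and wp\<mu>: "well_posed (frozen b \<mu>) (frozen \<sigma> \<mu>) M\<^sub>0 Z\<^sub>0"
    and \<mu>: "\<mu> \<in> P1"
  shows "invariant_measure (law_at b \<sigma> M\<^sub>0 Z\<^sub>0) \<mu> \<longleftrightarrow> invariant_measure (decoupled_law_at b \<sigma> M\<^sub>0 Z\<^sub>0 \<mu>) \<mu>"
proof
  assume inv: "invariant_measure (law_at b \<sigma> M\<^sub>0 Z\<^sub>0) \<mu>"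
  obtain M F Z X where sol: "weak_solution b \<sigma> M\<^sub>0 Z\<^sub>0 \<mu> M F Z X"
    and law: "\<And>t. 0 \<le> t \<Longrightarrow> law_at b \<sigma> M\<^sub>0 Z\<^sub>0 t \<mu> = law M (X t)"
    using wp \<mu> by (rule well_posed_obtains_solution) (rule that)
  have const: "law M (X t) = \<mu>" if "0 \<le> t" for t
    using inv law[OF that] that by (simp add: invariant_measure_def)
  have "weak_solution (frozen b \<mu>) (frozen \<sigma> \<mu>) M\<^sub>0 Z\<^sub>0 \<mu> M F Z X"
    using sol by (rule weak_solution_cong) (simp_all add: frozen_def const)
  from law_at_eq[OF wp\<mu> \<mu> this] show "invariant_measure (decoupled_law_at b \<sigma> M\<^sub>0 Z\<^sub>0 \<mu>) \<mu>"
    by (simp add: invariant_measure_def \<mu> const)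
next
  assume inv: "invariant_measure (decoupled_law_at b \<sigma> M\<^sub>0 Z\<^sub>0 \<mu>) \<mu>"
  obtain M F Z X where sol: "weak_solution (frozen b \<mu>) (frozen \<sigma> \<mu>) M\<^sub>0 Z\<^sub>0 \<mu> M F Z X"
    and law: "\<And>t. 0 \<le> t \<Longrightarrow> decoupled_law_at b \<sigma> M\<^sub>0 Z\<^sub>0 \<mu> t \<mu> = law M (X t)"
    using wp\<mu> \<mu> by (rule well_posed_obtains_solution) (rule that)
  have const: "law M (X t) = \<mu>" if "0 \<le> t" for t
    using inv law[OF that] that by (simp add: invariant_measure_def)
  have "weak_solution b \<sigma> M\<^sub>0 Z\<^sub>0 \<mu> M F Z X"
    using sol by (rule weak_solution_cong) (simp_all add: frozen_def const)
  from law_at_eq[OF wp \<mu> this] show "invariant_measure (law_at b \<sigma> M\<^sub>0 Z\<^sub>0) \<mu>"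
    by (simp add: invariant_measure_def \<mu> const)
qed

section \<open>Contraction and convergence\<close>

text \<open>Starting measure for the fixed point iteration.\<close>

lemma return_in_P1: "return borel (0 :: 'a::euclidean_space) \<in> P1"
  by (simp add: P1_iff prob_measures_def prob_space_return nn_integral_return)

text \<open>On the time grid \<open>n * t\<^sub>1\<close> the distance to \<open>\<nu>\<close> decays geometrically, and the bound on
  \<open>{0..t\<^sub>1}\<close> controls the times in between.\<close>

lemma exponential_convergence:
  fixes P :: "real \<Rightarrow> 'a::euclidean_space measure \<Rightarrow> 'a measure"
  assumes P1: "\<And>t \<eta>. 0 \<le> t \<Longrightarrow> \<eta> \<in> P1 \<Longrightarrow> P t \<eta> \<in> P1"
    and semigroup: "\<And>s t \<eta>. 0 \<le> s \<Longrightarrow> 0 \<le> t \<Longrightarrow> \<eta> \<in> P1 \<Longrightarrow> P (s + t) \<eta> = P t (P s \<eta>)"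
    and t\<^sub>1: "0 < t\<^sub>1" and \<kappa>: "\<kappa> < 1"
    and step: "\<And>\<eta>. \<eta> \<in> P1 \<Longrightarrow> W1 (P t\<^sub>1 \<eta>) \<nu> \<le> ennreal \<kappa> * W1 \<eta> \<nu>"
    and bound: "\<And>t \<eta>. 0 \<le> t \<Longrightarrow> t \<le> t\<^sub>1 \<Longrightarrow> \<eta> \<in> P1 \<Longrightarrow> W1 (P t \<eta>) \<nu> \<le> ennreal A * W1 \<eta> \<nu>"
  shows "\<exists>c>0. \<exists>lam>0. \<forall>t\<ge>0. \<forall>\<eta>\<in>P1. W1 (P t \<eta>) \<nu> \<le> ennreal (c * exp (- lam * t)) * W1 \<eta> \<nu>"
proof -
  \<comment> \<open>\<kappa> may be zero or negative; raising it to at least \<open>1 / 2\<close>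
    gives \<open>ln q\<close> its meaning, and \<open>lam\<close> is the rate at which one grid step
    costs exactly the factor \<open>q\<close>.\<close>
  define q where "q = max \<kappa> (1 / 2)"
  have q: "0 < q" "q < 1" "\<kappa> \<le> q" using \<kappa> by (auto simp: q_def)
  define lam where "lam = - ln q / t\<^sub>1"
  have lam: "0 < lam" using q t\<^sub>1 by (simp add: lam_def divide_neg_pos)
  have exp_lam: "exp (- lam * t\<^sub>1) = q" using q t\<^sub>1 by (simp add: lam_def)
  define B where "B = max A 1"
  have grid: "W1 (P (real n * t\<^sub>1) \<eta>) \<nu> \<le> ennreal (B * q ^ n) * W1 \<eta> \<nu>" if \<eta>: "\<eta> \<in> P1" for n \<eta>
  proof (induction n)
    case 0
    \<comment> \<open>\<open>P 0 \<eta>\<close> is not known to be \<eta>, so the grid starts from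
      the bound at time \<open>0\<close> and picks up a factor \<open>B\<close>.\<close>
    have "W1 (P 0 \<eta>) \<nu> \<le> ennreal A * W1 \<eta> \<nu>" using bound[of 0 \<eta>] t\<^sub>1 \<eta> by simp
    also have "\<dots> \<le> ennreal B * W1 \<eta> \<nu>" by (intro mult_right_mono ennreal_leI) (auto simp: B_def)
    finally show ?case by simp
  next
    case (Suc n)
    have grid_P1: "P (real n * t\<^sub>1) \<eta> \<in> P1" using P1[OF _ \<eta>] t\<^sub>1 by simp
    have "real (Suc n) * t\<^sub>1 = real n * t\<^sub>1 + t\<^sub>1" by (simp add: algebra_simps)
    then have "W1 (P (real (Suc n) * t\<^sub>1) \<eta>) \<nu> = W1 (P t\<^sub>1 (P (real n * t\<^sub>1) \<eta>)) \<nu>"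
      using semigroup[of "real n * t\<^sub>1" t\<^sub>1 \<eta>] t\<^sub>1 \<eta> by simp
    also have "\<dots> \<le> ennreal \<kappa> * W1 (P (real n * t\<^sub>1) \<eta>) \<nu>" by (rule step[OF grid_P1])
    also have "\<dots> \<le> ennreal q * (ennreal (B * q ^ n) * W1 \<eta> \<nu>)"
      using q by (intro mult_mono Suc.IH ennreal_leI) auto
    also have "\<dots> = ennreal (B * q ^ Suc n) * W1 \<eta> \<nu>"
    proof -
      have "ennreal q * ennreal (B * q ^ n) = ennreal (B * q ^ Suc n)"
        using q by (subst ennreal_mult'[symmetric]) (simp_all add: mult_ac)
      then show ?thesis by (simp only: mult.assoc[symmetric])
    qed
    finally show ?case .
  qed
  show ?thesis
  proof (intro exI conjI allI impI ballI)
    \<comment> \<open>One \<open>B\<close> comes from the start of the grid, one from the last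
      incomplete step, and \<open>1 / q\<close> from rounding \<open>t\<close> down to the
      grid.\<close>
    show "0 < B * B / q" using q by (simp add: B_def)
    show "0 < lam" by fact
    fix t :: real and \<eta> :: "'a measure" assume t: "0 \<le> t" and \<eta>: "\<eta> \<in> P1"
    define n where "n = nat \<lfloor>t / t\<^sub>1\<rfloor>"
    define r where "r = t - real n * t\<^sub>1"
    have n: "real n = of_int \<lfloor>t / t\<^sub>1\<rfloor>" using t t\<^sub>1 by (simp add: n_def)
    have "real n \<le> t / t\<^sub>1" "t / t\<^sub>1 < real n + 1" unfolding n by linarith+
    then have r: "0 \<le> r" "r \<le> t\<^sub>1" using t\<^sub>1 by (simp_all add: r_def field_simps)
    have grid_P1: "P (real n * t\<^sub>1) \<eta> \<in> P1" using P1[OF _ \<eta>] t\<^sub>1 by simp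
    have "q ^ n = exp (- lam * (real n * t\<^sub>1))"
      unfolding exp_lam[symmetric] by (simp add: exp_of_nat_mult[symmetric] mult_ac)
    also have "\<dots> = exp (- lam * t) * exp (lam * r)" by (simp add: r_def algebra_simps flip: exp_add)
    also have "\<dots> \<le> exp (- lam * t) * exp (lam * t\<^sub>1)" using lam r by simp
    also have "exp (lam * t\<^sub>1) = 1 / q" using exp_lam q by (simp add: exp_minus field_simps)
    finally have qn: "q ^ n \<le> exp (- lam * t) / q" by simp
    have "W1 (P t \<eta>) \<nu> = W1 (P r (P (real n * t\<^sub>1) \<eta>)) \<nu>"
      using semigroup[of "real n * t\<^sub>1" r \<eta>] r t\<^sub>1 \<eta> by (simp add: r_def)
    also have "\<dots> \<le> ennreal A * W1 (P (real n * t\<^sub>1) \<eta>) \<nu>" by (rule bound[OF r grid_P1])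
    also have "\<dots> \<le> ennreal B * (ennreal (B * q ^ n) * W1 \<eta> \<nu>)"
      by (intro mult_mono grid[OF \<eta>] ennreal_leI) (auto simp: B_def)
    also have "\<dots> = ennreal (B * (B * q ^ n)) * W1 \<eta> \<nu>"
    proof -
      have "0 \<le> B" by (simp add: B_def)
      from ennreal_mult'[OF this] show ?thesis by (simp only: mult.assoc)
    qed
    also have "\<dots> \<le> ennreal (B * B / q * exp (- lam * t)) * W1 \<eta> \<nu>"
      using mult_left_mono[OF qn, of "B * B"] by (intro mult_right_mono ennreal_leI) (auto simp: mult.assoc)
    finally show "W1 (P t \<eta>) \<nu> \<le> ennreal (B * B / q * exp (- lam * t)) * W1 \<eta> \<nu>" .
  qed
qed

theorem theorem2p1:
  fixes b :: "real^'d \<Rightarrow> (real^'d) measure \<Rightarrow> real^'d"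
    and \<sigma> :: "real^'d \<Rightarrow> (real^'d) measure \<Rightarrow> real^'n^'d"
    and M :: "'w measure" and F :: "real \<Rightarrow> 'w measure" and Z :: "real \<Rightarrow> 'w \<Rightarrow> real^'n"
    and \<Gamma> :: "(real^'d) measure \<Rightarrow> (real^'d) measure"
    and c\<^sub>0 lam\<^sub>0 :: real
  assumes "measurable_coefficient b" and "bounded_on_bounded_sets b"
    and "measurable_coefficient \<sigma>" and "bounded_on_bounded_sets \<sigma>"
    and "complete_filtered_prob_space M F" and "levy_process M F Z"
    and "well_posed b \<sigma> M Z"
    and "\<forall>\<mu>\<in>P1. well_posed (frozen b \<mu>) (frozen \<sigma> \<mu>) M Z"
    and "c\<^sub>0 \<ge> 1" and "lam\<^sub>0 > 0"
    and "\<forall>\<mu>\<in>P1. invariant_measure (decoupled_law_at b \<sigma> M Z \<mu>) (\<Gamma> \<mu>) \<and>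
           (\<forall>\<nu>. invariant_measure (decoupled_law_at b \<sigma> M Z \<mu>) \<nu> \<longrightarrow> \<nu> = \<Gamma> \<mu>)"
    and "\<forall>t\<ge>0. \<forall>\<eta>\<in>P1. \<forall>\<mu>\<in>P1.
           W1 (decoupled_law_at b \<sigma> M Z \<mu> t \<eta>) (\<Gamma> \<mu>) \<le> ennreal (c\<^sub>0 * exp (- lam\<^sub>0 * t)) * W1 \<eta> (\<Gamma> \<mu>)"
  shows "(\<forall>G :: real \<Rightarrow> real.
            continuous_on {0..} G \<and> (\<forall>t\<ge>0. G t \<ge> 0) \<and>
            (INF t\<in>{ln c\<^sub>0 / lam\<^sub>0<..}. G t / (1 - c\<^sub>0 * exp (- lam\<^sub>0 * t))) \<in> {0..<1} \<and>
            (\<forall>t\<ge>0. \<forall>\<mu>\<^sub>1\<in>P1. \<forall>\<mu>\<^sub>2\<in>P1.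
               W1 (decoupled_law_at b \<sigma> M Z \<mu>\<^sub>1 t (\<Gamma> \<mu>\<^sub>2)) (\<Gamma> \<mu>\<^sub>2) \<le> ennreal (G t) * W1 \<mu>\<^sub>1 \<mu>\<^sub>2)
            \<longrightarrow> (\<exists>!\<mu>. invariant_measure (law_at b \<sigma> M Z) \<mu>))
       \<and> (\<forall>(\<nu> :: (real^'d) measure) (t\<^sub>1 :: real) (H :: real \<Rightarrow> real).
            invariant_measure (law_at b \<sigma> M Z) \<nu> \<and> t\<^sub>1 > 0 \<and>
            continuous_on {0..t\<^sub>1} H \<and> (\<forall>t\<in>{0..t\<^sub>1}. H t \<ge> 0) \<and>
            H t\<^sub>1 + c\<^sub>0 * exp (- lam\<^sub>0 * t\<^sub>1) < 1 \<and>
            (\<forall>\<eta>\<in>P1. \<forall>t\<in>{0..t\<^sub>1}. W1 (law_at b \<sigma> M Z t \<eta>) (decoupled_law_at b \<sigma> M Z \<nu> t \<eta>) \<le> ennreal (H t) * W1 \<eta> \<nu>)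
            \<longrightarrow> (\<exists>c>0. \<exists>lam>0. \<forall>t\<ge>0. \<forall>\<eta>\<in>P1.
                   W1 (law_at b \<sigma> M Z t \<eta>) \<nu> \<le> ennreal (c * exp (- lam * t)) * W1 \<eta> \<nu>))"
proof (intro conjI allI impI)
  let ?P = "law_at b \<sigma> M Z" and ?Q = "decoupled_law_at b \<sigma> M Z"
  note wp = assms(7) and wp_frozen = assms(8)[rule_format] and c\<^sub>0 = assms(9) and lam\<^sub>0 = assms(10)
    and inv = assms(11)[rule_format] and ergodic = assms(12)[rule_format]
  have \<Gamma>: "\<Gamma> \<mu> \<in> P1" if "\<mu> \<in> P1" for \<mu>
    using inv[OF that] by (simp add: invariant_measure_def)
  have Q_P1: "?Q \<mu> t \<eta> \<in> P1" if "\<mu> \<in> P1" "\<eta> \<in> P1" "0 \<le> t" for \<mu> \<eta> t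
    using wp_frozen[OF that(1)] that(2,3) by (rule law_at_P1)
  \<comment> \<open>Combines the passage between the two equations with the uniqueness of
    \<open>\<Gamma> \<mu>\<close>; both parts of the theorem use invariance through this
    equivalence.\<close>
  have fixed_iff: "invariant_measure ?P \<mu> \<longleftrightarrow> \<mu> \<in> P1 \<and> \<Gamma> \<mu> = \<mu>" for \<mu>
  proof (cases "\<mu> \<in> P1")
    case True
    from invariant_iff_frozen[OF wp wp_frozen[OF True] True] inv[OF True] True show ?thesis by metis
  qed (simp add: invariant_measure_def)
  {
    fix G :: "real \<Rightarrow> real"
    assume G: "continuous_on {0..} G \<and> (\<forall>t\<ge>0. G t \<ge> 0) \<and>
            (INF t\<in>{ln c\<^sub>0 / lam\<^sub>0<..}. G t / (1 - c\<^sub>0 * exp (- lam\<^sub>0 * t))) \<in> {0..<1} \<and>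
            (\<forall>t\<ge>0. \<forall>\<mu>\<^sub>1\<in>P1. \<forall>\<mu>\<^sub>2\<in>P1. W1 (?Q \<mu>\<^sub>1 t (\<Gamma> \<mu>\<^sub>2)) (\<Gamma> \<mu>\<^sub>2) \<le> ennreal (G t) * W1 \<mu>\<^sub>1 \<mu>\<^sub>2)"
    \<comment> \<open>The infimum need not be attained; being below \<open>1\<close> it rules out
      \<open>1\<close> as a lower bound, and a single such time is enough.\<close>
    have "\<exists>t\<in>{ln c\<^sub>0 / lam\<^sub>0<..}. G t / (1 - c\<^sub>0 * exp (- lam\<^sub>0 * t)) < 1"
    proof (rule ccontr)
      assume "\<not> ?thesis"
      then have "1 \<le> (INF t\<in>{ln c\<^sub>0 / lam\<^sub>0<..}. G t / (1 - c\<^sub>0 * exp (- lam\<^sub>0 * t)))"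
        by (intro cINF_greatest) (auto simp: not_less)
      with G show False by simp
    qed
    then obtain t where t: "ln c\<^sub>0 / lam\<^sub>0 < t" and Gt: "G t / (1 - c\<^sub>0 * exp (- lam\<^sub>0 * t)) < 1" by auto
    define q where "q = c\<^sub>0 * exp (- lam\<^sub>0 * t)"
    have "0 \<le> ln c\<^sub>0 / lam\<^sub>0" using c\<^sub>0 lam\<^sub>0 by simp
    with t have t0: "0 \<le> t" by simp
    have q0: "0 \<le> q" using c\<^sub>0 by (simp add: q_def)
    \<comment> \<open>The lower limit for \<open>t\<close> under the infimum is exactly the
      condition \<open>q < 1\<close>.\<close>
    have "c\<^sub>0 < exp (lam\<^sub>0 * t)"
      using t c\<^sub>0 lam\<^sub>0 by (subst ln_less_cancel_iff[symmetric]) (auto simp: field_simps)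
    then have q1: "q < 1" by (simp add: q_def exp_minus field_simps)
    have G0: "0 \<le> G t" using G t0 by simp
    have "W1 (\<Gamma> \<mu>\<^sub>1) (\<Gamma> \<mu>\<^sub>2) \<le> ennreal (G t / (1 - q)) * W1 \<mu>\<^sub>1 \<mu>\<^sub>2" if \<mu>: "\<mu>\<^sub>1 \<in> P1" "\<mu>\<^sub>2 \<in> P1" for \<mu>\<^sub>1 \<mu>\<^sub>2
    proof -
      obtain x where x: "W1 (\<Gamma> \<mu>\<^sub>1) (\<Gamma> \<mu>\<^sub>2) = ennreal x" "0 \<le> x"
        using W1_finite[OF \<Gamma>[OF \<mu>(1)] \<Gamma>[OF \<mu>(2)]] by (cases "W1 (\<Gamma> \<mu>\<^sub>1) (\<Gamma> \<mu>\<^sub>2)" rule: ennreal_cases) auto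
      obtain w where w: "W1 \<mu>\<^sub>1 \<mu>\<^sub>2 = ennreal w" "0 \<le> w"
        using W1_finite[OF \<mu>] by (cases "W1 \<mu>\<^sub>1 \<mu>\<^sub>2" rule: ennreal_cases) auto
      \<comment> \<open>The flow frozen at \<open>\<mu>\<^sub>1\<close> and started in
        \<open>\<Gamma> \<mu>\<^sub>2\<close> is drawn to \<open>\<Gamma> \<mu>\<^sub>1\<close> by
        ergodicity, while \<open>G\<close> keeps it near
        \<open>\<Gamma> \<mu>\<^sub>2\<close>.\<close>
      have "ennreal x \<le> W1 (\<Gamma> \<mu>\<^sub>1) (?Q \<mu>\<^sub>1 t (\<Gamma> \<mu>\<^sub>2)) + W1 (?Q \<mu>\<^sub>1 t (\<Gamma> \<mu>\<^sub>2)) (\<Gamma> \<mu>\<^sub>2)"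
        unfolding x(1)[symmetric] by (rule W1_triangle[OF P1_prob_measures[OF \<Gamma>[OF \<mu>(2)]]])
      also have "\<dots> \<le> ennreal q * W1 (\<Gamma> \<mu>\<^sub>2) (\<Gamma> \<mu>\<^sub>1) + ennreal (G t) * W1 \<mu>\<^sub>1 \<mu>\<^sub>2"
        using ergodic[OF t0 \<Gamma>[OF \<mu>(2)] \<mu>(1)] G t0 \<mu> unfolding q_def
        by (intro add_mono) (simp_all add: W1_commute[of "\<Gamma> \<mu>\<^sub>1"])
      also have "\<dots> = ennreal (q * x + G t * w)"
        using x w q0 G0 by (simp add: W1_commute[of "\<Gamma> \<mu>\<^sub>2"] ennreal_mult')
      finally have "x \<le> q * x + G t * w"
        using x w q0 G0 by (subst (asm) ennreal_le_iff) simp_all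
      \<comment> \<open>\<open>x\<close> is a real number, so \<open>q * x\<close> can be subtracted
        and \<open>1 - q\<close> divided out.\<close>
      then have "x \<le> G t / (1 - q) * w" using q1 by (simp add: field_simps)
      then show ?thesis
        using x w q1 G0 by (simp add: ennreal_leI flip: ennreal_mult')
    qed
    then have "\<exists>!\<mu>. \<mu> \<in> P1 \<and> \<Gamma> \<mu> = \<mu>"
      using \<Gamma> Gt q1 G0 return_in_P1 by (intro W1_contraction_fixed_point[of \<Gamma> "G t / (1 - q)"]) (auto simp: q_def)
    then show "\<exists>!\<mu>. invariant_measure ?P \<mu>" unfolding fixed_iff .
  }
  fix \<nu> :: "(real^'d) measure" and t\<^sub>1 :: real and H :: "real \<Rightarrow> real"
  assume A: "invariant_measure ?P \<nu> \<and> t\<^sub>1 > 0 \<and>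
            continuous_on {0..t\<^sub>1} H \<and> (\<forall>t\<in>{0..t\<^sub>1}. H t \<ge> 0) \<and>
            H t\<^sub>1 + c\<^sub>0 * exp (- lam\<^sub>0 * t\<^sub>1) < 1 \<and>
            (\<forall>\<eta>\<in>P1. \<forall>t\<in>{0..t\<^sub>1}. W1 (?P t \<eta>) (?Q \<nu> t \<eta>) \<le> ennreal (H t) * W1 \<eta> \<nu>)"
  \<comment> \<open>Since \<nu> is fixed by \<Gamma>, the ergodic estimate for the flow frozen at
    \<nu> already measures the distance to \<nu>.\<close>
  then have \<nu>: "\<nu> \<in> P1" and \<Gamma>\<nu>: "\<Gamma> \<nu> = \<nu>" by (auto simp: fixed_iff)
  have bound: "W1 (?P t \<eta>) \<nu> \<le> ennreal (H t + c\<^sub>0 * exp (- lam\<^sub>0 * t)) * W1 \<eta> \<nu>"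
    if t: "0 \<le> t" "t \<le> t\<^sub>1" and \<eta>: "\<eta> \<in> P1" for t \<eta>
  proof -
    have "W1 (?P t \<eta>) \<nu> \<le> W1 (?P t \<eta>) (?Q \<nu> t \<eta>) + W1 (?Q \<nu> t \<eta>) \<nu>"
      by (rule W1_triangle[OF P1_prob_measures[OF \<nu>]])
    also have "\<dots> \<le> ennreal (H t) * W1 \<eta> \<nu> + ennreal (c\<^sub>0 * exp (- lam\<^sub>0 * t)) * W1 \<eta> \<nu>"
      using A t \<eta> ergodic[OF t(1) \<eta> \<nu>] by (intro add_mono) (simp_all add: \<Gamma>\<nu>)
    also have "\<dots> = ennreal (H t + c\<^sub>0 * exp (- lam\<^sub>0 * t)) * W1 \<eta> \<nu>"
      using A t c\<^sub>0 by (simp add: ennreal_plus distrib_right)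
    finally show ?thesis .
  qed
  \<comment> \<open>The times between grid points need one constant for the whole interval;
    compactness of \<open>{0..t\<^sub>1}\<close> provides it.\<close>
  have "bounded (H ` {0..t\<^sub>1})"
    using A by (intro compact_imp_bounded compact_continuous_image) auto
  then obtain h where "\<forall>x\<in>H ` {0..t\<^sub>1}. \<bar>x\<bar> \<le> h"
    unfolding bounded_iff real_norm_def by (elim exE)
  then have h: "H t \<le> h" if "0 \<le> t" "t \<le> t\<^sub>1" for t
    using that by (auto dest: abs_le_D1)
  show "\<exists>c>0. \<exists>lam>0. \<forall>t\<ge>0. \<forall>\<eta>\<in>P1. W1 (?P t \<eta>) \<nu> \<le> ennreal (c * exp (- lam * t)) * W1 \<eta> \<nu>"
  proof (rule exponential_convergence)
    show "?P t \<eta> \<in> P1" if "0 \<le> t" "\<eta> \<in> P1" for t \<eta>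
      using wp that(2,1) by (rule law_at_P1)
    show "?P (s + t) \<eta> = ?P t (?P s \<eta>)" if "0 \<le> s" "0 \<le> t" "\<eta> \<in> P1" for s t \<eta>
      using wp that(3,1,2) by (rule law_at_semigroup)
    show "0 < t\<^sub>1" "H t\<^sub>1 + c\<^sub>0 * exp (- lam\<^sub>0 * t\<^sub>1) < 1" using A by auto
    show "W1 (?P t\<^sub>1 \<eta>) \<nu> \<le> ennreal (H t\<^sub>1 + c\<^sub>0 * exp (- lam\<^sub>0 * t\<^sub>1)) * W1 \<eta> \<nu>" if "\<eta> \<in> P1" for \<eta>
      using A by (intro bound that) auto
    show "W1 (?P t \<eta>) \<nu> \<le> ennreal (h + c\<^sub>0) * W1 \<eta> \<nu>" if "0 \<le> t" "t \<le> t\<^sub>1" "\<eta> \<in> P1" for t \<eta>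
    proof (rule order.trans[OF bound[OF that] mult_right_mono[OF ennreal_leI]])
      have "exp (- lam\<^sub>0 * t) \<le> 1" using lam\<^sub>0 that by simp
      then have "c\<^sub>0 * exp (- lam\<^sub>0 * t) \<le> c\<^sub>0" using c\<^sub>0 by (simp add: mult_left_le)
      with h[OF that(1,2)] show "H t + c\<^sub>0 * exp (- lam\<^sub>0 * t) \<le> h + c\<^sub>0" by simp
    qed simp
  qed
qed

end
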